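(* Let $G=(V,E)$ be an equatorial graph with minimum degree $\delta$, girth $g$ and equator $q$, and let $k=\lceil g/2\rceil-1$. Then $G$ is $\delta$-regular and every vertex of $G$ lies on an isometric cycle of length $q$. Moreover, $V$ admits a unique partition $V=L_0\cup\dots\cup L_{q-1}$ (indices mod $q$) with the following properties, where $u$ is any vertex in a part $L_i$: (a) $u$ has a neighbor in $L_{i-1}$ and a neighbor in $L_{i+1}$; (b) $\mathcal{D}_1(u)\subseteq L_{i-1}\cup L_i\cup L_{i+1}$; (c) every isometric cycle of length $q$ in $G$ has exactly one vertex in each part $L_j$; (d) for any vertices $v\in L_{i-k}$ and $w\in L_{i+k}$, $L_i=\mathcal{D}_k(v)\cap\mathcal{D}_k(w)$; (e) $|L_j|=|L_{j+g}|$ for all $j$; (f) $|L_j|+\dots+|L_{j+g-1}|=M(\delta,g)$ for all $j$.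
   Context: For a vertex $u$, $\mathcal{D}_i(u)=\{v: d(u,v)\le i\}$. A cycle $C$ is isometric if $d_C(x,y)=d_G(x,y)$ for all $x,y\in V(C)$; the equator is the length of a longest isometric cycle. For $\delta\ge2$, $g\ge3$, $k=\lceil g/2\rceil-1$, the Moore bound is $M(\delta,g)=1+\sum_{i=0}^{k-1}\delta(\delta-1)^i$ for odd $g$ and $M(\delta,g)=2+\sum_{i=1}^{k}2(\delta-1)^i$ for even $g$. An equatorial graph is a finite graph with girth $g$, minimum degree $\delta$ and equator $q>6k+3$ whose order is exactly $\frac{q}{g}M(\delta,g)$. *)

theory Defs
  imports Complex_Main "HOL-Library.Extended_Nat" "HOL-Library.Disjoint_Sets"
begin

text \<open>A graph is given by its vertex set and its set of edges, the edges being two-element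
  sets of vertices. Graphs are not assumed to be connected.\<close>

definition finite_graph :: "'a set \<Rightarrow> 'a set set \<Rightarrow> bool" where
  "finite_graph V E \<longleftrightarrow>
     finite V \<and> (\<forall>e\<in>E. \<exists>u\<in>V. \<exists>v\<in>V. u \<noteq> v \<and> e = {u, v})"

definition degree :: "'a set \<Rightarrow> 'a set set \<Rightarrow> 'a \<Rightarrow> nat" where
  "degree V E u = card {v \<in> V. {u, v} \<in> E}"

definition min_degree :: "'a set \<Rightarrow> 'a set set \<Rightarrow> nat" where
  "min_degree V E = Min (degree V E ` V)"

definition walk :: "'a set \<Rightarrow> 'a set set \<Rightarrow> 'a \<Rightarrow> 'a list \<Rightarrow> 'a \<Rightarrow> bool" where
  "walk V E u p v \<longleftrightarrow> p \<noteq> [] \<and> hd p = u \<and> last p = v \<and> set p \<subseteq> V \<and>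
     (\<forall>i. Suc i < length p \<longrightarrow> {p ! i, p ! Suc i} \<in> E)"

text \<open>A walk with \<open>n\<close> vertices has length \<open>n - 1\<close>. The distance is \<open>\<infinity>\<close> if there is no walk.\<close>

definition gdist :: "'a set \<Rightarrow> 'a set set \<Rightarrow> 'a \<Rightarrow> 'a \<Rightarrow> enat" where
  "gdist V E u v = (INF p\<in>{p. walk V E u p v}. enat (length p - 1))"

definition gball :: "'a set \<Rightarrow> 'a set set \<Rightarrow> nat \<Rightarrow> 'a \<Rightarrow> 'a set" where
  "gball V E i u = {v \<in> V. gdist V E u v \<le> enat i}"

text \<open>A cycle is represented by a list of its vertices in cyclic order; as a graph it has
  vertex set \<open>set cs\<close> and edge set \<open>cycle_edges cs\<close>.\<close>

definition cycle_edges :: "'a list \<Rightarrow> 'a set set" where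
  "cycle_edges cs = {{cs ! i, cs ! (Suc i mod length cs)} | i. i < length cs}"

definition is_cycle :: "'a set \<Rightarrow> 'a set set \<Rightarrow> 'a list \<Rightarrow> bool" where
  "is_cycle V E cs \<longleftrightarrow>
     3 \<le> length cs \<and> distinct cs \<and> set cs \<subseteq> V \<and> cycle_edges cs \<subseteq> E"

definition isometric_cycle :: "'a set \<Rightarrow> 'a set set \<Rightarrow> 'a list \<Rightarrow> bool" where
  "isometric_cycle V E cs \<longleftrightarrow> is_cycle V E cs \<and>
     (\<forall>x\<in>set cs. \<forall>y\<in>set cs. gdist (set cs) (cycle_edges cs) x y = gdist V E x y)"

text \<open>The girth is \<open>\<infinity>\<close> if there is no cycle. The equator is \<open>0\<close> if there is no isometric cycle;
  in a finite graph that has one, the supremum is attained.\<close>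

definition girth :: "'a set \<Rightarrow> 'a set set \<Rightarrow> enat" where
  "girth V E = (INF cs\<in>{cs. is_cycle V E cs}. enat (length cs))"

definition equator :: "'a set \<Rightarrow> 'a set set \<Rightarrow> enat" where
  "equator V E = (SUP cs\<in>{cs. isometric_cycle V E cs}. enat (length cs))"

definition moore_radius :: "nat \<Rightarrow> nat" where
  "moore_radius g = nat \<lceil>real g / 2\<rceil> - 1"

definition moore_bound :: "nat \<Rightarrow> nat \<Rightarrow> nat" where
  "moore_bound \<delta> g =
     (if odd g then 1 + (\<Sum>i<moore_radius g. \<delta> * (\<delta> - 1) ^ i)
      else 2 + (\<Sum>i=1..moore_radius g. 2 * (\<delta> - 1) ^ i))"

definition equatorial_graph :: "'a set \<Rightarrow> 'a set set \<Rightarrow> nat \<Rightarrow> nat \<Rightarrow> nat \<Rightarrow> bool" where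
  "equatorial_graph V E \<delta> g q \<longleftrightarrow>
     finite_graph V E \<and> \<delta> \<ge> 2 \<and> g \<ge> 3 \<and>
     min_degree V E = \<delta> \<and> girth V E = enat g \<and> equator V E = enat q \<and>
     q > 6 * moore_radius g + 3 \<and>
     real (card V) = real q / real g * real (moore_bound \<delta> g)"

text \<open>A partition into \<open>q\<close> parts with indices modulo \<open>q\<close> is a \<open>q\<close>-periodic family indexed by
  the integers.\<close>

definition cyclic_partition :: "'a set \<Rightarrow> nat \<Rightarrow> (int \<Rightarrow> 'a set) \<Rightarrow> bool" where
  "cyclic_partition V q L \<longleftrightarrow>
     (\<forall>j. L (j + int q) = L j) \<and> inj_on L {0..<int q} \<and> partition_on V (L ` {0..<int q})"

definition equatorial_partition ::
    "'a set \<Rightarrow> 'a set set \<Rightarrow> nat \<Rightarrow> nat \<Rightarrow> nat \<Rightarrow> (int \<Rightarrow> 'a set) \<Rightarrow> bool" where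
  "equatorial_partition V E \<delta> g q L \<longleftrightarrow> (let k = moore_radius g in
     cyclic_partition V q L \<and>
     (\<forall>i. \<forall>u\<in>L i. (\<exists>v\<in>L (i - 1). {u, v} \<in> E) \<and> (\<exists>v\<in>L (i + 1). {u, v} \<in> E)) \<and>
     (\<forall>i. \<forall>u\<in>L i. gball V E 1 u \<subseteq> L (i - 1) \<union> L i \<union> L (i + 1)) \<and>
     (\<forall>cs. isometric_cycle V E cs \<and> length cs = q \<longrightarrow> (\<forall>j. \<exists>!v. v \<in> set cs \<and> v \<in> L j)) \<and>
     (\<forall>i. \<forall>v\<in>L (i - int k). \<forall>w\<in>L (i + int k). L i = gball V E k v \<inter> gball V E k w) \<and>
     (\<forall>j. card (L j) = card (L (j + int g))) \<and>
     (\<forall>j. (\<Sum>t<g. card (L (j + int t))) = moore_bound \<delta> g))"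

text \<open>Rotating or reflecting the index cycle preserves the defining properties of an equatorial
  partition, so a partition with indices modulo \<open>q\<close> can be unique only up to such a relabelling.\<close>

definition cyclic_relabelling :: "(int \<Rightarrow> 'a set) \<Rightarrow> (int \<Rightarrow> 'a set) \<Rightarrow> bool" where
  "cyclic_relabelling L L' \<longleftrightarrow>
     (\<exists>r. (\<forall>j. L' j = L (r + j)) \<or> (\<forall>j. L' j = L (r - j)))"

end

theory Submission
  imports Defs
begin

text \<open>Let \<open>c\<close> be an isometric cycle of length \<open>q\<close>. By the Moore bound, each ball of radius \<open>k\<close> around a
  vertex of \<open>c\<close> (for even \<open>g\<close>, around an edge of \<open>c\<close>) has at least \<open>M(\<delta>, g)\<close> vertices, and since
  \<open>q > 6k\<close> every vertex of \<open>G\<close> lies in at most \<open>g\<close> of these \<open>q\<close> balls. The order being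
  \<open>q M(\<delta>, g) / g\<close>, equality holds throughout. Hence every vertex \<open>v\<close> has a centre \<open>f v\<close> modulo \<open>q\<close>
  such that \<open>v\<close> is within distance \<open>k\<close> of the cycle vertices with indices \<open>f v \<plusminus> k\<close>. The bound
  \<open>q > 6k + 3\<close> makes \<open>f\<close> 1-Lipschitz, so a section of \<open>f\<close> that is a closed walk is again an isometric
  cycle; rerouting \<open>c\<close> through \<open>v\<close> gives such a section. The layers are the fibres of \<open>f\<close>.\<close>

section \<open>Distances and isometric cycles\<close>

text \<open>The threshold on \<open>q\<close> comes from comparing the centres of two adjacent
  vertices: the congruences modulo \<open>q\<close> that arise involve three quantities of sizes
  \<open>2 * k\<close>, \<open>2 * k + 1\<close> and \<open>2 * k + 1\<close>, and become equalities
  because \<open>6 * k + 2 < q\<close>. Two extreme cycle vertices suffice to pin a centre, since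
  their indices are \<open>2 * k\<close> apart and only the midpoint is within \<open>k\<close> of
  both. The layers are built from one cycle, whereas (c), (d) and uniqueness speak about all
  vertices, cycles and partitions. For a cycle that meets layer \<open>j\<close> at its own index
  \<open>j\<close>, repeating the counting along that cycle yields the same centres; this gives (d).
  An arbitrary isometric cycle of length \<open>q\<close> has no such alignment: composed with
  \<open>f\<close>, it is only a closed 1-Lipschitz walk of residues modulo \<open>q\<close>. A
  winding-number argument shows that this walk goes around exactly once, in one of the two
  directions. The same argument, applied to the base cycle and the index function of a second
  partition, gives uniqueness up to rotation and reflection.\<close>

lemma gdist_le_iff:
  "gdist V E u v \<le> enat n \<longleftrightarrow>
    (\<exists>m f. m \<le> n \<and> f 0 = u \<and> f m = v \<and> (\<forall>i\<le>m. f i \<in> V) \<and> (\<forall>i<m. {f i, f (Suc i)} \<in> E))"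
  (is "_ \<longleftrightarrow> ?R")
proof
  assume le: "gdist V E u v \<le> enat n"
  define S where "S = (\<lambda>p. enat (length p - 1)) ` {p. walk V E u p v}"
  have "Inf S \<le> enat n" using le by (simp add: gdist_def S_def)
  \<comment> \<open>An infimum of a nonempty set of \<open>enat\<close> is attained, so a finite
    bound comes from an actual walk.\<close>
  then have "S \<noteq> {}" by (auto simp: Inf_enat_def top_enat_def)
  then have "Inf S \<in> S" unfolding Inf_enat_def by (auto intro: LeastI)
  with \<open>Inf S \<le> enat n\<close> obtain p where p: "walk V E u p v" "length p - 1 \<le> n"
    by (auto simp: S_def)
  have "length p \<noteq> 0" using p by (auto simp: walk_def)
  then have "(!) p 0 = u \<and> (!) p (length p - 1) = v \<and> (\<forall>i\<le>length p - 1. p ! i \<in> V) \<and>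
      (\<forall>i<length p - 1. {p ! i, p ! Suc i} \<in> E)"
    using p nth_mem[of _ p]
    by (auto simp: walk_def hd_conv_nth last_conv_nth subset_iff less_Suc_eq_le[symmetric])
  then show ?R using p(2) by blast
next
  assume ?R
  then obtain m f where f: "m \<le> n" "f 0 = u" "f m = v" "\<forall>i\<le>m. f i \<in> V"
    "\<forall>i<m. {f i, f (Suc i)} \<in> E" by blast
  have "walk V E u (map f [0..<Suc m]) v"
    using f by (auto simp: walk_def hd_map last_map nth_append simp del: upt_Suc)
  then have "gdist V E u v \<le> enat (length (map f [0..<Suc m]) - 1)"
    unfolding gdist_def by (intro INF_lower) simp
  then show "gdist V E u v \<le> enat n"
    using f(1) by (simp del: upt_Suc) (meson enat_ord_simps(1) order_trans)
qed

lemma gdist_refl_le: "u \<in> V \<Longrightarrow> gdist V E u u \<le> enat n"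
  unfolding gdist_le_iff by (intro exI[of _ 0] exI[of _ "\<lambda>_. u"]) auto

lemma gdist_edge_le:
  assumes "u \<in> V" "v \<in> V" "{u, v} \<in> E"
  shows "gdist V E u v \<le> enat 1"
  unfolding gdist_le_iff
  by (intro exI[of _ 1] exI[of _ "\<lambda>i. if i = 0 then u else v"]) (use assms in auto)

lemma gdist_sym_le:
  assumes "gdist V E u v \<le> enat n"
  shows "gdist V E v u \<le> enat n"
proof -
  obtain m f where f: "m \<le> n" "f 0 = u" "f m = v" "\<forall>i\<le>m. f i \<in> V" "\<forall>i<m. {f i, f (Suc i)} \<in> E"
    using assms by (auto simp: gdist_le_iff)
  have "{f (m - i), f (m - Suc i)} \<in> E" if "i < m" for i
    using f(5)[rule_format, of "m - Suc i"] that
    by (simp add: insert_commute Suc_diff_Suc)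
  then show ?thesis
    unfolding gdist_le_iff
    by (intro exI[of _ m] exI[of _ "\<lambda>i. f (m - i)"]) (use f in auto)
qed

lemma walk_concat:
  assumes f: "\<forall>i\<le>a. f i \<in> V" "\<forall>i<a. {f i, f (Suc i)} \<in> E"
    and h: "\<forall>i\<le>b. h i \<in> V" "\<forall>i<b. {h i, h (Suc i)} \<in> E"
    and fh: "f a = h 0"
  obtains l where "\<And>i. i \<le> a \<Longrightarrow> l i = f i" "l (a + b) = h b"
    "\<forall>i\<le>a + b. l i \<in> V" "\<forall>i<a + b. {l i, l (Suc i)} \<in> E"
proof
  let ?l = "\<lambda>i. if i \<le> a then f i else h (i - a)"
  have "{?l i, ?l (Suc i)} \<in> E" if "i < a + b" for i
  proof -
    consider "i < a" | "i = a" | "a < i" by linarith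
    then show ?thesis
    proof cases
      case 2
      then show ?thesis using h(2)[rule_format, of 0] that fh by auto
    next
      case 3
      then show ?thesis using h(2)[rule_format, of "i - a"] that by (auto simp: Suc_diff_le)
    qed (use f in auto)
  qed
  then show "\<forall>i<a + b. {?l i, ?l (Suc i)} \<in> E" by blast
qed (use f h fh in auto)

lemma gdist_triangle_le:
  assumes "gdist V E u v \<le> enat m" "gdist V E v w \<le> enat n"
  shows "gdist V E u w \<le> enat (m + n)"
proof -
  obtain a f where f: "a \<le> m" "f 0 = u" "f a = v" "\<forall>i\<le>a. f i \<in> V" "\<forall>i<a. {f i, f (Suc i)} \<in> E"
    using assms(1) by (auto simp: gdist_le_iff)
  obtain b h where h: "b \<le> n" "h 0 = v" "h b = w" "\<forall>i\<le>b. h i \<in> V" "\<forall>i<b. {h i, h (Suc i)} \<in> E"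
    using assms(2) by (auto simp: gdist_le_iff)
  obtain l where "\<And>i. i \<le> a \<Longrightarrow> l i = f i" "l (a + b) = h b"
    "\<forall>i\<le>a + b. l i \<in> V" "\<forall>i<a + b. {l i, l (Suc i)} \<in> E"
    using walk_concat[of a f V E b h] f h by auto
  then show ?thesis
    unfolding gdist_le_iff using f(1,2) h(1,3)
    by (intro exI[of _ "a + b"] exI[of _ l]) auto
qed

lemma gdist_mono_subgraph:
  assumes "V' \<subseteq> V" "E' \<subseteq> E"
  shows "gdist V E u v \<le> gdist V' E' u v"
  unfolding gdist_def by (intro INF_superset_mono) (use assms in \<open>auto simp: walk_def\<close>)

section \<open>Cyclic distance on the integers modulo \<open>q\<close>\<close>

definition near :: "nat \<Rightarrow> nat \<Rightarrow> int \<Rightarrow> int \<Rightarrow> bool" where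
  "near q n a b \<longleftrightarrow> (\<exists>x. \<bar>x\<bar> \<le> int n \<and> int q dvd b - a - x)"

lemma nearI: "\<bar>x\<bar> \<le> int n \<Longrightarrow> int q dvd b - a - x \<Longrightarrow> near q n a b"
  by (auto simp: near_def)

lemma nearE:
  assumes "near q n a b"
  obtains x where "\<bar>x\<bar> \<le> int n" "int q dvd b - a - x"
  using assms by (auto simp: near_def)

lemma near_sym: "near q n a b \<Longrightarrow> near q n b a"
proof -
  assume "near q n a b"
  then obtain x where "\<bar>x\<bar> \<le> int n" "int q dvd b - a - x" by (auto simp: near_def)
  then show "near q n b a"
    by (intro nearI[of "- x"]) (auto simp: dvd_diff_commute algebra_simps)
qed

lemma near_trans:
  assumes "near q m a b" "near q n b c"
  shows "near q (m + n) a c"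
proof -
  obtain x y where "\<bar>x\<bar> \<le> int m" "int q dvd b - a - x" "\<bar>y\<bar> \<le> int n" "int q dvd c - b - y"
    using assms by (auto simp: near_def)
  moreover from this have "int q dvd (b - a - x) + (c - b - y)" by (blast intro: dvd_add)
  ultimately show ?thesis
    by (intro nearI[of "x + y"]) (auto simp: algebra_simps)
qed

lemma near_mono: "near q m a b \<Longrightarrow> m \<le> n \<Longrightarrow> near q n a b"
  by (force simp: near_def)

lemma near_0: "near q 0 a b \<longleftrightarrow> int q dvd b - a"
  by (auto simp: near_def)

lemma near_cong:
  assumes "near q n a b" "int q dvd a' - a" "int q dvd b' - b"
  shows "near q n a' b'"
proof -
  have "near q 0 a' a" "near q 0 b b'"
    using assms(2,3) by (auto simp: near_0 dvd_diff_commute)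
  then show ?thesis using near_trans near_trans assms(1) by (metis add_0 add.right_neutral)
qed

text \<open>The size of \<open>q\<close> mostly enters here: congruences between quantities that are
  small compared with \<open>q\<close> become equalities.\<close>

lemma small_dvd_eq_0:
  assumes "int q dvd x" "\<bar>x\<bar> < int q"
  shows "x = 0"
  using assms zdvd_not_zless[of "\<bar>x\<bar>" "int q"] by (metis abs_0_eq abs_ge_zero dvd_abs_iff order_le_less)

text \<open>The residues \<open>b - k\<close> and \<open>b + k\<close> are \<open>2 * k\<close>
  apart, so \<open>a\<close> has to be their midpoint; \<open>4 * k < q\<close> rules out going
  around the other way. Centres are identified with this.\<close>

lemma near_squeeze:
  assumes "near q k a (b - int k)" "near q k a (b + int k)" "4 * k < q"
  shows "int q dvd b - a"
proof -
  obtain x y where xy: "\<bar>x\<bar> \<le> int k" "int q dvd b - int k - a - x" "\<bar>y\<bar> \<le> int k" "int q dvd b + int k - a - y"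
    using assms by (auto simp: near_def)
  then have "int q dvd (b + int k - a - y) - (b - int k - a - x)" by (blast intro: dvd_diff)
  then have "int q dvd 2 * int k - y + x" by (simp add: algebra_simps)
  then have "2 * int k - y + x = 0"
    by (rule small_dvd_eq_0) (use xy(1,3) assms(3) in linarith)
  then have "y = int k" using xy(1,3) by linarith
  then show ?thesis using xy(4) by simp
qed

lemma near_of_gdist_le:
  assumes lip: "\<And>a b. a \<in> V \<Longrightarrow> b \<in> V \<Longrightarrow> {a, b} \<in> E \<Longrightarrow> near q 1 (f a) (f b)"
    and "gdist V E u v \<le> enat n"
  shows "near q n (f u) (f v)"
proof -
  obtain m h where h: "m \<le> n" "h 0 = u" "h m = v" "\<forall>i\<le>m. h i \<in> V" "\<forall>i<m. {h i, h (Suc i)} \<in> E"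
    using assms(2) by (auto simp: gdist_le_iff)
  have "i \<le> m \<Longrightarrow> near q i (f (h 0)) (f (h i))" for i
  proof (induction i)
    case 0
    then show ?case by (simp add: near_0)
  next
    case (Suc i)
    then show ?case using lip[of "h i" "h (Suc i)"] h near_trans[of q i _ "f (h i)" 1] by auto
  qed
  then show ?thesis using h near_mono by blast
qed

lemma gdist_along_le:
  fixes c :: "int \<Rightarrow> 'a"
  assumes c: "\<And>i. c i \<in> V" "\<And>i. {c i, c (i + 1)} \<in> E"
  shows "gdist V E (c i) (c (i + x)) \<le> enat (nat \<bar>x\<bar>)"
proof -
  have *: "gdist V E (c i) (c (i + int n)) \<le> enat n" for i n
    unfolding gdist_le_iff
    using c(2)[of "i + int _"] c(1)
    by (intro exI[of _ n] exI[of _ "\<lambda>j. c (i + int j)"]) (auto simp: algebra_simps)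
  show ?thesis
  proof (cases "x \<ge> 0")
    case True
    then show ?thesis using *[of i "nat x"] by simp
  next
    case False
    then show ?thesis using gdist_sym_le[OF *[of "i + x" "nat (- x)"]] by simp
  qed
qed

text \<open>Isometric cycles as doubly infinite sequences of period \<open>q\<close>.\<close>

definition isoseq :: "'a set \<Rightarrow> 'a set set \<Rightarrow> nat \<Rightarrow> (int \<Rightarrow> 'a) \<Rightarrow> bool" where
  "isoseq V E q c \<longleftrightarrow> (\<forall>i. c i \<in> V) \<and> (\<forall>i. {c i, c (i + 1)} \<in> E) \<and>
     (\<forall>i j. int q dvd i - j \<longrightarrow> c i = c j) \<and>
     (\<forall>i j n. gdist V E (c i) (c j) \<le> enat n \<longrightarrow> near q n i j)"

lemma isoseqD:
  assumes "isoseq V E q c"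
  shows "c i \<in> V" "{c i, c (i + 1)} \<in> E" "int q dvd i - j \<Longrightarrow> c i = c j"
    "gdist V E (c i) (c j) \<le> enat n \<Longrightarrow> near q n i j"
  using assms by (auto simp: isoseq_def)

lemma isoseq_inj: "isoseq V E q c \<Longrightarrow> c i = c j \<longleftrightarrow> int q dvd i - j"
  using isoseqD(4)[of V E q c i j 0] isoseqD(1,3)[of V E q c]
  by (metis gdist_refl_le near_0 dvd_diff_commute)

lemma isoseq_of_isometric_cycle:
  assumes "isometric_cycle V E cs"
  shows "isoseq V E (length cs) (\<lambda>i. cs ! nat (i mod int (length cs)))"
    "range (\<lambda>i. cs ! nat (i mod int (length cs))) = set cs"
proof -
  define q where "q = length cs"
  define c where "c i = cs ! nat (i mod int q)" for i :: int
  have cyc: "3 \<le> q" "distinct cs" "set cs \<subseteq> V" "cycle_edges cs \<subseteq> E"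
    and iso: "\<And>x y. x \<in> set cs \<Longrightarrow> y \<in> set cs \<Longrightarrow>
      gdist (set cs) (cycle_edges cs) x y = gdist V E x y"
    using assms by (auto simp: isometric_cycle_def is_cycle_def q_def)
  have lt: "nat (i mod int q) < q" for i
    using cyc(1) by (metis Euclidean_Rings.pos_mod_bound gr0I le_zero_eq nat_int of_nat_0_less_iff zero_neq_numeral zless_nat_conj)
  have c_in: "c i \<in> set cs" for i using lt by (simp add: c_def q_def)
  have suc: "nat ((i + 1) mod int q) = Suc (nat (i mod int q)) mod q" for i
  proof -
    have "nat ((i + 1) mod int q) = nat ((i mod int q + 1) mod int q)" by (simp add: mod_add_left_eq)
    also have "i mod int q + 1 = int (Suc (nat (i mod int q)))" using cyc(1) by simp
    also have "nat (\<dots> mod int q) = Suc (nat (i mod int q)) mod q"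
      by (metis nat_int zmod_int)
    finally show ?thesis .
  qed
  have c_edge: "{c i, c (i + 1)} \<in> cycle_edges cs" for i
    unfolding cycle_edges_def c_def suc using lt[of i] by (auto simp: q_def)
  have per: "c i = c j" if "int q dvd i - j" for i j
    using that by (simp add: c_def mod_eq_dvd_iff[symmetric])
  \<comment> \<open>The position of a vertex on the cycle. An edge of the cycle changes it by one
    modulo \<open>q\<close>, so a distance bound inside the cycle bounds the cyclic distance of
    positions; isometry transfers this to distances in the graph.\<close>
  define f where "f x = int (THE i. i < q \<and> cs ! i = x)" for x
  have f_nth: "f (cs ! i) = int i" if "i < q" for i
    using that cyc(2) by (auto simp: f_def q_def nth_eq_iff_index_eq)
  have "near q n i j" if le: "gdist V E (c i) (c j) \<le> enat n" for i j n
  proof -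
    have step: "near q 1 (int i) (int (Suc i mod q))" if "i < q" for i
      by (rule nearI[of 1]) (auto simp: zmod_int mod_eq_dvd_iff[symmetric] diff_diff_eq add.commute)
    have "near q n (f (c i)) (f (c j))"
    proof (rule near_of_gdist_le[of "set cs" "cycle_edges cs"])
      fix a b assume "{a, b} \<in> cycle_edges cs"
      then obtain i where i: "i < q" "{a, b} = {cs ! i, cs ! (Suc i mod q)}"
        by (auto simp: cycle_edges_def q_def)
      have "Suc i mod q < q" using cyc(1) by simp
      with step[OF i(1)] i show "near q 1 (f a) (f b)"
        by (auto simp: doubleton_eq_iff f_nth near_sym)
    qed (use le iso c_in in auto)
    then show ?thesis
      by (rule near_cong) (use lt cyc(1) in \<open>simp_all add: c_def f_nth mod_eq_dvd_iff[symmetric]\<close>)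
  qed
  then show "isoseq V E (length cs) (\<lambda>i. cs ! nat (i mod int (length cs)))"
    using c_in c_edge cyc per unfolding isoseq_def c_def q_def by blast
  have "cs ! i \<in> range c" if "i < q" for i
    using that by (intro image_eqI[of _ _ "int i"]) (auto simp: c_def)
  then show "range (\<lambda>i. cs ! nat (i mod int (length cs))) = set cs"
    using c_in unfolding c_def q_def by (auto simp: in_set_conv_nth)
qed

lemma isometric_cycle_of_isoseq:
  assumes c: "isoseq V E q c" and q: "3 \<le> q"
  defines "cs \<equiv> map (\<lambda>i. c (int i)) [0..<q]"
  shows "isometric_cycle V E cs" "length cs = q" "set cs = range c"
proof -
  show len: "length cs = q" by (simp add: cs_def)
  have nth: "cs ! i = c (int i)" if "i < q" for i using that by (simp add: cs_def)
  have mod: "c i = cs ! nat (i mod int q)" for i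
  proof -
    have "nat (i mod int q) < q" using q by (simp add: nat_less_iff)
    moreover have "int q dvd i - i mod int q" by (simp add: mod_eq_dvd_iff[symmetric])
    ultimately show ?thesis using isoseqD(3)[OF c] q by (simp add: nth)
  qed
  have "c i \<in> set cs" for i
    unfolding mod[of i] using q len by (intro nth_mem) (simp add: nat_less_iff)
  then show set: "set cs = range c" by (auto simp: cs_def)
  have "distinct cs"
    unfolding distinct_conv_nth len
  proof safe
    fix i j assume ij: "i < q" "j < q" "i \<noteq> j" "cs ! i = cs ! j"
    then have "int q dvd int i - int j" by (simp add: nth isoseq_inj[OF c])
    then have "int i - int j = 0" using ij by (intro small_dvd_eq_0) auto
    then show False using ij by simp
  qed
  have edges: "{cs ! i, cs ! (Suc i mod q)} = {c (int i), c (int i + 1)}" if "i < q" for i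
  proof -
    have "int q dvd (int i + 1) - int (Suc i mod q)"
      by (simp add: zmod_int mod_eq_dvd_iff[symmetric] add.commute)
    then have "c (int i + 1) = c (int (Suc i mod q))" by (rule isoseqD(3)[OF c])
    then show ?thesis using that q by (simp add: nth)
  qed
  have "{c i, c (i + 1)} \<in> cycle_edges cs" for i
  proof -
    define j where "j = nat (i mod int q)"
    have j: "j < q" "int q dvd i - int j" using q
      by (simp_all add: j_def nat_less_iff mod_eq_dvd_iff[symmetric])
    then have "c i = c (int j)" "c (i + 1) = c (int j + 1)" by (auto intro!: isoseqD(3)[OF c])
    then have "{c i, c (i + 1)} = {cs ! j, cs ! (Suc j mod length cs)}"
      using edges[OF j(1)] len by simp
    then show ?thesis using j len unfolding cycle_edges_def by blast
  qed
  note along = gdist_along_le[of c "set cs" "cycle_edges cs", OF _ this]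
  have sub: "set cs \<subseteq> V" "cycle_edges cs \<subseteq> E"
    using isoseqD(1,2)[OF c] by (auto simp: set cycle_edges_def len edges)
  \<comment> \<open>Only this inequality uses the isometry condition: it supplies a shift
    \<open>x\<close> of size at most \<open>n\<close>, and following the cycle for that many steps
    realises it. The converse is monotonicity under subgraphs.\<close>
  have "gdist (set cs) (cycle_edges cs) (c i) (c j) \<le> gdist V E (c i) (c j)" for i j
  proof (cases "gdist V E (c i) (c j)")
    case (enat n)
    then have "near q n i j" using isoseqD(4)[OF c] by simp
    then obtain x where x: "\<bar>x\<bar> \<le> int n" "int q dvd j - i - x" by (auto simp: near_def)
    then have "c j = c (i + x)" by (intro isoseqD(3)[OF c]) (simp add: algebra_simps)
    then have "gdist (set cs) (cycle_edges cs) (c i) (c j) \<le> enat (nat \<bar>x\<bar>)"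
      using along set by simp
    also have "\<dots> \<le> enat n" using x by simp
    finally show ?thesis using enat by simp
  qed simp
  then show "isometric_cycle V E cs"
    unfolding isometric_cycle_def is_cycle_def
    using q len \<open>distinct cs\<close> sub gdist_mono_subgraph[OF sub] set
    by (auto intro: antisym)
qed

section \<open>Non-backtracking walks and the Moore bound\<close>

text \<open>Non-backtracking is a local condition, so extending or gluing walks needs a check only
  at the seam. Within the girth such walks are paths anyway.\<close>

fun nbw :: "'a set \<Rightarrow> 'a set set \<Rightarrow> 'a list \<Rightarrow> bool" where
  "nbw V E [] \<longleftrightarrow> False"
| "nbw V E [x] \<longleftrightarrow> x \<in> V"
| "nbw V E (x # y # p) \<longleftrightarrow> x \<in> V \<and> {x, y} \<in> E \<and> (p \<noteq> [] \<longrightarrow> hd p \<noteq> x) \<and> nbw V E (y # p)"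

lemma nbw_tl: "nbw V E (x # p) \<Longrightarrow> p \<noteq> [] \<Longrightarrow> nbw V E p"
  by (cases p) auto

lemma nbw_set: "nbw V E p \<Longrightarrow> set p \<subseteq> V"
  by (induction V E p rule: nbw.induct) auto

lemma nbw_edge: "nbw V E p \<Longrightarrow> Suc i < length p \<Longrightarrow> {p ! i, p ! Suc i} \<in> E"
proof (induction V E p arbitrary: i rule: nbw.induct)
  case (3 V E x y p)
  then show ?case by (cases i) auto
qed auto

text \<open>Gluing of two walks with common start \<open>x\<close>: back along \<open>q\<close> to
  \<open>x\<close>, then out along \<open>p\<close>. The condition on the heads prevents
  backtracking at \<open>x\<close>.\<close>

lemma nbw_rev_append:
  assumes "nbw V E (x # q)" "nbw V E (x # p)" "p = [] \<or> q = [] \<or> hd p \<noteq> hd q"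
  shows "nbw V E (rev q @ x # p)"
  using assms
proof (induction q arbitrary: x p)
  case (Cons y q)
  have "nbw V E (y # q)" using Cons.prems(1) by simp
  moreover have "nbw V E (y # x # p)"
    using Cons.prems nbw_set[OF \<open>nbw V E (y # q)\<close>] by (auto simp: insert_commute)
  moreover have "q = [] \<or> hd (x # p) \<noteq> hd q" using Cons.prems(1) by auto
  ultimately show ?case using Cons.IH[of y "x # p"] by simp
qed auto

lemma nbw_rev: "nbw V E p \<Longrightarrow> nbw V E (rev p)"
  using nbw_rev_append[of V E "hd p" "tl p" "[]"] nbw_set[of V E p] by (cases p) auto

lemma girth_le: "is_cycle V E cs \<Longrightarrow> girth V E \<le> enat (length cs)"
  unfolding girth_def by (rule INF_lower) simp

text \<open>If \<open>x\<close> recurs at position \<open>j\<close> of the duplicate-free rest, the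
  first \<open>j + 1\<close> vertices form a cycle that is too short. Here \<open>j = 0\<close>
  would be a loop and \<open>j = 1\<close> an immediate return, so the cycle has at least three
  vertices.\<close>

lemma nbw_distinct:
  assumes simple: "\<And>x. {x} \<notin> E"
  shows "nbw V E p \<Longrightarrow> enat (length p) \<le> girth V E \<Longrightarrow> distinct p"
proof (induction p)
  case (Cons x p)
  show ?case
  proof (cases "p = []")
    case False
    then have "nbw V E p" using Cons.prems(1) nbw_tl by metis
    moreover have "enat (length p) \<le> girth V E"
      using Cons.prems(2) by (rule order_trans[rotated]) simp
    ultimately have dp: "distinct p" using Cons.IH by blast
    have "x \<notin> set p"
    proof
      assume "x \<in> set p"
      then obtain j where j: "j < length p" "p ! j = x" by (auto simp: in_set_conv_nth)
      obtain y r where p: "p = y # r" using False by (cases p) auto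
      have "j \<noteq> 0" using j Cons.prems(1) simple[of x] p by (cases j) auto
      moreover have "j \<noteq> 1" using j Cons.prems(1) p by (cases r; cases "j = 1") auto
      ultimately have j2: "2 \<le> j" by linarith
      define cs where "cs = take (Suc j) (x # p)"
      have len: "length cs = Suc j" using j by (simp add: cs_def)
      have nth: "cs ! i = (x # p) ! i" if "i \<le> j" for i using that by (simp add: cs_def del: take_Suc_Cons)
      have "x \<notin> set (take j p)"
        using j dp by (auto simp: in_set_conv_nth nth_eq_iff_index_eq)
      then have dc: "distinct cs" using dp by (simp add: cs_def)
      have "{cs ! i, cs ! (Suc i mod Suc j)} \<in> E" if "i \<le> j" for i
      proof -
        have "cs ! (Suc i mod Suc j) = (x # p) ! Suc i"
          using that j by (cases "i = j") (auto simp: nth)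
        then show ?thesis using that nbw_edge[OF Cons.prems(1), of i] j by (auto simp: nth)
      qed
      moreover have "set cs \<subseteq> V" using nbw_set[OF Cons.prems(1)] set_take_subset[of "Suc j" "x # p"]
        by (auto simp: cs_def)
      ultimately have "is_cycle V E cs"
        using dc len j2 by (auto simp: is_cycle_def cycle_edges_def)
      then have "girth V E \<le> enat (Suc j)" using girth_le len by metis
      with Cons.prems(2) have "enat (length (x # p)) \<le> enat (Suc j)" by (rule order_trans)
      then show False using j by simp
    qed
    then show ?thesis using dp by simp
  qed simp
qed simp

text \<open>Common first steps cancel. Where the walks separate, reversing one and appending the
  other gives a non-backtracking walk whose number of vertices is at most the girth but which
  contains the common end twice.\<close>

lemma nbw_unique:
  assumes simple: "\<And>x. {x} \<notin> E"
  shows "nbw V E (v # p) \<Longrightarrow> nbw V E (v # q) \<Longrightarrow> last (v # p) = last (v # q) \<Longrightarrow>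
    enat (length p + length q) < girth V E \<Longrightarrow> p = q"
proof (induction p arbitrary: v q)
  case Nil
  have "distinct (v # q)"
    using Nil.prems(2,4) by (intro nbw_distinct[OF simple]) (auto simp: eSuc_enat[symmetric] intro: ileI1)
  then show ?case using Nil.prems(3) by (auto split: if_splits)
next
  case (Cons y p)
  have le: "enat (Suc (length (y # p) + length q)) \<le> girth V E"
    using Cons.prems(4) by (metis Suc_ile_eq)
  show ?case
  proof (cases q)
    case Nil
    have "distinct (v # y # p)"
      using Cons.prems(1) le Nil by (intro nbw_distinct[OF simple]) auto
    then show ?thesis using Cons.prems(3) Nil last_in_set[of "y # p"] by auto
  next
    case (Cons z r)
    show ?thesis
    proof (cases "y = z")
      case True
      have "enat (length p + length r) < girth V E"
        using Cons.prems(4) Cons by (auto elim!: less_trans[rotated])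
      then have "p = r" using Cons.IH[of y r] Cons.prems Cons True by auto
      then show ?thesis using True Cons by simp
    next
      case False
      have "nbw V E (rev q @ v # y # p)"
        using Cons.prems Cons False by (intro nbw_rev_append) auto
      moreover have "enat (length (rev q @ v # y # p)) \<le> girth V E"
        using le by (simp add: add.commute)
      ultimately have "distinct (rev q @ v # y # p)" by (rule nbw_distinct[OF simple])
      moreover have "last (y # p) \<in> set q" using Cons.prems(3) Cons last_in_set[of q] by auto
      ultimately show ?thesis using last_in_set[of "y # p"] by (metis (no_types) disjoint_iff distinct_append list.distinct(1) list.set_intros(2) set_rev)
    qed
  qed
qed

abbreviation nbrs :: "'a set \<Rightarrow> 'a set set \<Rightarrow> 'a \<Rightarrow> 'a set" where
  "nbrs V E u \<equiv> {v \<in> V. {u, v} \<in> E}"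

text \<open>A branch of length \<open>n\<close> is a non-backtracking walk that starts at the root \<open>u\<close>, listed from its
  end to its root; its first step avoids \<open>X\<close>.\<close>

primrec branches :: "'a set \<Rightarrow> 'a set set \<Rightarrow> 'a \<Rightarrow> 'a set \<Rightarrow> nat \<Rightarrow> 'a list set" where
  "branches V E u X 0 = {[u]}"
| "branches V E u X (Suc n) =
     {y # p | y p. p \<in> branches V E u X n \<and> nbw V E (y # p) \<and> (n = 0 \<longrightarrow> y \<notin> X)}"

lemma branches_nbw:
  assumes "u \<in> V" "p \<in> branches V E u X n"
  shows "nbw V E p" "length p = Suc n" "last p = u"
  using assms(2)
proof (induction n arbitrary: p)
  case (Suc n) 
  { case 1 then show ?case by auto
  next case 2 then show ?case using Suc by auto
  next case 3 then show ?case using Suc by fastforce }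
qed (use assms(1) in auto)

lemma branches_nonempty: "p \<in> branches V E u X n \<Longrightarrow> p \<noteq> []"
  by (cases n) auto

lemma branches_avoid:
  assumes "p @ [x, u] \<in> branches V E u X n"
  shows "x \<notin> X"
  using assms
proof (induction n arbitrary: p)
  case (Suc n)
  then show ?case
    by (cases p; cases n) (auto dest: branches_nonempty)
qed auto

lemma branches_hd_dist:
  assumes "u \<in> V" "p \<in> branches V E u X n"
  shows "gdist V E u (hd p) \<le> enat n"
  using assms(2)
proof (induction n arbitrary: p)
  case (Suc n)
  then obtain y r where p: "p = y # r" "r \<in> branches V E u X n" "nbw V E (y # r)" by auto
  have "r \<noteq> []" using branches_nbw(2)[OF assms(1) p(2)] by auto
  then obtain z s where r: "r = z # s" by (cases r) auto
  have "gdist V E z y \<le> enat 1"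
    using p(3) nbw_set[OF p(3)] by (intro gdist_edge_le) (auto simp: r insert_commute)
  then have "gdist V E u y \<le> enat (n + 1)"
    using gdist_triangle_le[of V E u z n y 1] Suc.IH[OF p(2)] r by simp
  then show ?case by (simp add: p)
qed (use assms(1) gdist_refl_le in force)

lemma edge_in_V:
  assumes "finite_graph V E" "{u, v} \<in> E"
  shows "u \<in> V" "v \<in> V"
proof -
  obtain a b where "a \<in> V" "b \<in> V" "{u, v} = {a, b}"
    using assms unfolding finite_graph_def by meson
  then show "u \<in> V" "v \<in> V" by (auto simp: doubleton_eq_iff)
qed

lemma no_loop:
  assumes "finite_graph V E"
  shows "{x} \<notin> E"
proof
  assume "{x} \<in> E"
  then obtain a b where "a \<noteq> b" "{x} = {a, b}"
    using assms unfolding finite_graph_def by meson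
  then show False by auto
qed

lemma finite_V: "finite_graph V E \<Longrightarrow> finite V" by (simp add: finite_graph_def)

section \<open>Lower bounds for balls by counting branches\<close>

context
  fixes V :: "'a set" and E :: "'a set set" and \<delta> :: nat
  assumes fg: "finite_graph V E" and deg: "\<And>v. v \<in> V \<Longrightarrow> \<delta> \<le> degree V E v"
begin

lemma finite_branches: "finite (branches V E u X n)"
proof (induction n)
  case (Suc n)
  have "branches V E u X (Suc n) \<subseteq> (\<lambda>(y, p). y # p) ` (V \<times> branches V E u X n)"
    by (fastforce dest: nbw_set)
  then show ?case using Suc finite_V[OF fg] by (meson finite_SigmaI finite_imageI finite_subset)
qed simp

text \<open>A branch extends to every neighbour of its end except the vertex it came from, hence in
  at least \<open>\<delta> - 1\<close> ways. The degree of the root is kept exact so that equality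
  in the Moore bound later reveals it.\<close>

lemma card_branches:
  assumes u: "u \<in> V" and X: "X \<subseteq> nbrs V E u"
  shows "(degree V E u - card X) * (\<delta> - 1) ^ n \<le> card (branches V E u X (Suc n))"
proof (induction n)
  case 0
  have "branches V E u X (Suc 0) = (\<lambda>y. [y, u]) ` (nbrs V E u - X)"
    using u by (auto simp: insert_commute)
  moreover have "card ((\<lambda>y. [y, u]) ` (nbrs V E u - X)) = card (nbrs V E u - X)"
    by (rule card_image) (auto simp: inj_on_def)
  ultimately show ?case
    using X finite_V[OF fg] by (simp add: card_Diff_subset finite_subset degree_def del: branches.simps)
next
  case (Suc n)
  let ?B = "branches V E u X (Suc n)"
  let ?S = "\<lambda>p. nbrs V E (hd p) - {hd (tl p)}"
  have "(\<lambda>(p, y). y # p) ` (SIGMA p:?B. ?S p) \<subseteq> branches V E u X (Suc (Suc n))"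
  proof
    fix x assume "x \<in> (\<lambda>(p, y). y # p) ` (SIGMA p:?B. ?S p)"
    then obtain p y where x: "x = y # p" and p: "p \<in> ?B"
      and y: "y \<in> V" "{hd p, y} \<in> E" "y \<notin> {hd (tl p)}" by (auto simp del: branches.simps)
    obtain a b r where "p = a # b # r"
      using branches_nbw(2)[OF u p] by (metis Suc_length_conv)
    then have "nbw V E (y # p)" using branches_nbw(1)[OF u p] y by (auto simp: insert_commute)
    then show "x \<in> branches V E u X (Suc (Suc n))" using p x by simp
  qed
  then have "card ((\<lambda>(p, y). y # p) ` (SIGMA p:?B. ?S p)) \<le> card (branches V E u X (Suc (Suc n)))"
    by (intro card_mono finite_branches)
  moreover have "card ((\<lambda>(p, y). y # p) ` (SIGMA p:?B. ?S p)) = (\<Sum>p\<in>?B. card (?S p))"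
  proof -
    have "inj_on (\<lambda>(p, y). y # p) (SIGMA p:?B. ?S p)" by (rule inj_onI) (clarsimp split: prod.splits)
    then show ?thesis
      using finite_branches[of u X "Suc n"] finite_V[OF fg] by (simp add: card_image del: branches.simps)
  qed
  moreover have "card ?B * (\<delta> - 1) \<le> (\<Sum>p\<in>?B. card (?S p))"
  proof -
    have "(\<Sum>p\<in>?B. \<delta> - 1) \<le> (\<Sum>p\<in>?B. card (?S p))"
    proof (rule sum_mono)
      fix p assume "p \<in> ?B"
      then have "nbw V E p" by (rule branches_nbw(1)[OF u])
      then have "hd p \<in> V" using nbw_set by (metis hd_in_set nbw.simps(1) subsetD)
      then have "\<delta> \<le> card (nbrs V E (hd p))" using deg unfolding degree_def by blast
      moreover have "card (nbrs V E (hd p)) - card {hd (tl p)} \<le> card (?S p)"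
        by (rule diff_card_le_card_Diff) simp
      ultimately show "\<delta> - 1 \<le> card (?S p)" by simp
    qed
    then show ?thesis by (simp only: sum_constant of_nat_id)
  qed
  moreover have "(degree V E u - card X) * (\<delta> - 1) ^ Suc n \<le> card ?B * (\<delta> - 1)"
    using mult_le_mono1[OF Suc, of "\<delta> - 1"] by (simp add: mult_ac)
  ultimately show ?case by linarith
qed

lemma card_branches_upto:
  assumes u: "u \<in> V" and X: "X \<subseteq> nbrs V E u"
  shows "card (\<Union>n\<le>k. branches V E u X n) \<ge> 1 + (degree V E u - card X) * (\<Sum>i<k. (\<delta> - 1) ^ i)"
proof -
  have "card (\<Union>n\<le>k. branches V E u X n) = (\<Sum>n\<le>k. card (branches V E u X n))"
    using finite_branches branches_nbw(2)[OF u]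
    by (intro card_UN_disjoint) (auto, metis nat.inject)
  also have "\<dots> = 1 + (\<Sum>n<k. card (branches V E u X (Suc n)))"
    by (simp add: lessThan_Suc_atMost[symmetric] sum.lessThan_Suc_shift del: branches.simps(2) sum.lessThan_Suc)
  also have "\<dots> \<ge> 1 + (\<Sum>n<k. (degree V E u - card X) * (\<delta> - 1) ^ n)"
    by (intro add_left_mono sum_mono card_branches u X)
  finally show ?thesis by (simp add: sum_distrib_left)
qed

text \<open>Two branches with the same end are walks from that end to \<open>u\<close> of total
  length at most \<open>2 * k\<close>, which is below the girth.\<close>

lemma inj_on_hd_branches:
  assumes u: "u \<in> V" and g: "enat (2 * k) < girth V E"
  shows "inj_on hd (\<Union>n\<le>k. branches V E u X n)"
proof (rule inj_onI, clarify)
  fix p r m n assume *: "m \<le> k" "p \<in> branches V E u X m" "n \<le> k" "r \<in> branches V E u X n" "hd p = hd r"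
  note p = branches_nbw[OF u *(2)] and r = branches_nbw[OF u *(4)]
  obtain v p' r' where pr: "p = v # p'" "r = v # r'" using p(2) r(2) *(5) by (cases p; cases r) auto
  have "enat (length p' + length r') \<le> enat (2 * k)" using * p r pr by auto
  then have "enat (length p' + length r') < girth V E" using g by (rule le_less_trans)
  then have "p' = r'" using p(1,3) r(1,3) unfolding pr by (intro nbw_unique[OF no_loop[OF fg]]) auto
  then show "p = r" by (simp add: pr)
qed

lemma hd_branches_subset_gball:
  assumes "u \<in> V"
  shows "hd ` (\<Union>n\<le>k. branches V E u X n) \<subseteq> gball V E k u"
proof clarify
  fix p n assume "n \<le> k" and p: "p \<in> branches V E u X n"
  have "p \<noteq> []" using branches_nbw(2)[OF assms p] by auto
  then have "hd p \<in> V" using nbw_set[OF branches_nbw(1)[OF assms p]] by auto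
  moreover have "gdist V E u (hd p) \<le> enat k"
    using branches_hd_dist[OF assms p] \<open>n \<le> k\<close> by (meson enat_ord_simps(1) order_trans)
  ultimately show "hd p \<in> gball V E k u" by (simp add: gball_def)
qed

lemma finite_gball: "finite (gball V E k u)"
  using finite_V[OF fg] by (simp add: gball_def)

lemma card_gball_ge:
  assumes u: "u \<in> V" and g: "enat (2 * k) < girth V E"
  shows "card (gball V E k u) \<ge> 1 + degree V E u * (\<Sum>i<k. (\<delta> - 1) ^ i)"
proof -
  have "1 + (degree V E u - card {}) * (\<Sum>i<k. (\<delta> - 1) ^ i) \<le> card (\<Union>n\<le>k. branches V E u {} n)"
    using card_branches_upto[OF u, of "{}" k] by simp
  also have "\<dots> = card (hd ` (\<Union>n\<le>k. branches V E u {} n))"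
    by (rule card_image[symmetric, OF inj_on_hd_branches[OF u g]])
  also have "\<dots> \<le> card (gball V E k u)"
    by (rule card_mono[OF finite_gball hd_branches_subset_gball[OF u]])
  finally show ?thesis by simp
qed

text \<open>The edge is the root: branches at \<open>u\<close> avoid \<open>w\<close> and branches
  at \<open>w\<close> avoid \<open>u\<close>. A common end would give two walks to \<open>u\<close>
  of total length at most \<open>2 * k + 1\<close>.\<close>

lemma card_gball_edge_ge:
  assumes e: "{u, w} \<in> E" and g: "enat (2 * k + 1) < girth V E"
  shows "card (gball V E k u \<union> gball V E k w) \<ge>
    2 + ((degree V E u - 1) + (degree V E w - 1)) * (\<Sum>i<k. (\<delta> - 1) ^ i)"
proof -
  have u: "u \<in> V" and w: "w \<in> V" and e': "{w, u} \<in> E"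
    using edge_in_V[OF fg e] e by (auto simp: insert_commute)
  let ?U = "\<Union>n\<le>k. branches V E u {w} n" and ?W = "\<Union>n\<le>k. branches V E w {u} n"
  have g': "enat (2 * k) < girth V E"
    using g by (rule less_trans[rotated]) simp
  have disj: "hd ` ?U \<inter> hd ` ?W = {}"
  proof (rule ccontr)
    assume "hd ` ?U \<inter> hd ` ?W \<noteq> {}"
    then obtain m n p r where *: "m \<le> k" "p \<in> branches V E u {w} m" "n \<le> k" "r \<in> branches V E w {u} n"
      "hd p = hd r" by auto
    note p = branches_nbw[OF u *(2)] and r = branches_nbw[OF w *(4)]
    obtain v p' r' where pr: "p = v # p'" "r = v # r'" using p(2) r(2) *(5) by (cases p; cases r) auto
    obtain s where s: "r = s @ [w]"
      using r(2,3) by (metis append_butlast_last_id list.size(3) nat.distinct(1))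
    \<comment> \<open>\<open>last s\<close> is the first step of \<open>r\<close> away from
      \<open>w\<close>; as it is not \<open>u\<close>, the walk stays non-backtracking when
      \<open>u\<close> is appended to \<open>r\<close>.\<close>
    have "last s \<noteq> u" if "s \<noteq> []"
    proof
      assume "last s = u"
      then have "r = butlast s @ [u, w]" using that s append_butlast_last_id[of s]
        by (metis append.assoc append_Cons append_Nil)
      then show False using branches_avoid[of _ u w V E "{u}" n] *(4) by auto
    qed
    moreover have "nbw V E (w # rev s)" using nbw_rev[OF r(1)] s by simp
    ultimately have "nbw V E (u # w # rev s)" using u e by (auto simp: hd_rev)
    then have "nbw V E (rev (u # w # rev s))" by (rule nbw_rev)
    then have "nbw V E (r @ [u])" by (simp add: s)
    then have "nbw V E (v # (r' @ [u]))" by (simp add: pr)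
    moreover have "enat (length p' + length (r' @ [u])) < girth V E"
    proof -
      have "enat (length p' + length (r' @ [u])) \<le> enat (2 * k + 1)" using p(2) r(2) * pr by auto
      then show ?thesis using g by (rule le_less_trans)
    qed
    \<comment> \<open>By uniqueness \<open>p\<close> must itself be \<open>r\<close> continued to
      \<open>u\<close>, so its first step from \<open>u\<close> is the excluded vertex
      \<open>w\<close>.\<close>
    ultimately have "p' = r' @ [u]"
      using p(1,3) unfolding pr by (intro nbw_unique[OF no_loop[OF fg]]) auto
    then have "p = r @ [u]" by (simp add: pr)
    then have "s @ [w, u] \<in> branches V E u {w} m" using *(2) s by simp
    then show False using branches_avoid by fastforce
  qed
  have "2 + ((degree V E u - 1) + (degree V E w - 1)) * (\<Sum>i<k. (\<delta> - 1) ^ i) \<le> card ?U + card ?W"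
    using card_branches_upto[OF u, of "{w}" k] card_branches_upto[OF w, of "{u}" k] e e' u w
    by (simp add: algebra_simps)
  also have "\<dots> = card (hd ` ?U) + card (hd ` ?W)"
    by (simp add: card_image inj_on_hd_branches u w g')
  also have "\<dots> = card (hd ` ?U \<union> hd ` ?W)"
    using disj by (intro card_Un_disjoint[symmetric]) (auto simp: finite_branches)
  also have "\<dots> \<le> card (gball V E k u \<union> gball V E k w)"
    by (intro card_mono Un_mono hd_branches_subset_gball u w finite_UnI finite_gball)
  finally show ?thesis .
qed

end

section \<open>Double counting along an isometric cycle\<close>

lemma moore_radius_cases: "odd g \<Longrightarrow> g = 2 * moore_radius g + 1"
  "even g \<Longrightarrow> g \<ge> 2 \<Longrightarrow> g = 2 * moore_radius g + 2"
proof -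
  assume "odd g"
  then obtain m where g: "g = 2 * m + 1" by (auto elim: oddE)
  have "\<lceil>real g / 2\<rceil> = int m + 1" by (rule ceiling_unique) (auto simp: g field_simps)
  then show "g = 2 * moore_radius g + 1" by (simp add: moore_radius_def g nat_add_distrib)
next
  assume "even g" "g \<ge> 2"
  then obtain m where g: "g = 2 * m" by (auto elim: evenE)
  have "\<lceil>real g / 2\<rceil> = int m" by (simp add: g)
  then show "g = 2 * moore_radius g + 2" using \<open>g \<ge> 2\<close> by (simp add: moore_radius_def g)
qed

locale equatorial =
  fixes V :: "'a set" and E :: "'a set set" and \<delta> g q :: nat
  assumes equatorial: "equatorial_graph V E \<delta> g q"
begin

definition k :: nat where "k = moore_radius g"

text \<open>With \<open>\<epsilon> = 0\<close> for odd and \<open>\<epsilon> = 1\<close> for even girth, the Moore bound counts the vertices near a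
  vertex (odd girth) or near an edge (even girth) of the cycle.\<close>

definition \<epsilon> :: nat where "\<epsilon> = (if odd g then 0 else 1)"

definition window :: "(int \<Rightarrow> 'a) \<Rightarrow> int \<Rightarrow> 'a set" where
  "window c i = gball V E k (c i) \<union> gball V E k (c (i + int \<epsilon>))"

lemma graph: "finite_graph V E" and \<delta>_ge: "2 \<le> \<delta>" and girth: "girth V E = enat g"
  and q_gt: "6 * k + 3 < q"
  using equatorial by (auto simp: equatorial_graph_def k_def)

lemma g_eq: "g = 2 * k + 1 + \<epsilon>" and \<epsilon>_le: "\<epsilon> \<le> 1" and k_pos: "1 \<le> k"
proof -
  have "3 \<le> g" using equatorial by (simp add: equatorial_graph_def)
  then show "g = 2 * k + 1 + \<epsilon>" using moore_radius_cases[of g] by (auto simp: \<epsilon>_def k_def)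
  show "\<epsilon> \<le> 1" by (simp add: \<epsilon>_def)
  show "1 \<le> k" using \<open>3 \<le> g\<close> \<open>g = 2 * k + 1 + \<epsilon>\<close> \<open>\<epsilon> \<le> 1\<close> by linarith
qed

lemma finV: "finite V" using finite_V[OF graph] .

lemma degree_ge: "v \<in> V \<Longrightarrow> \<delta> \<le> degree V E v"
  using equatorial finV unfolding equatorial_graph_def min_degree_def by (metis Min_le finite_imageI imageI)

lemma card_V: "card V * g = q * moore_bound \<delta> g"
proof -
  have "real (card V) = real q / real g * real (moore_bound \<delta> g)" "g \<noteq> 0"
    using equatorial by (auto simp: equatorial_graph_def)
  then have "real (card V * g) = real (q * moore_bound \<delta> g)" by (simp add: field_simps)
  then show ?thesis by (rule of_nat_eq_iff[THEN iffD1])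
qed

lemma isoseq_exists: "\<exists>c. isoseq V E q c"
proof -
  define S where "S = (\<lambda>cs. enat (length cs)) ` {cs. isometric_cycle V E cs}"
  have sup: "Sup S = enat q" using equatorial by (simp add: equatorial_graph_def equator_def S_def)
  \<comment> \<open>In \<open>enat\<close> the supremum of the empty set is \<open>0\<close> and
    that of an infinite set is infinite. As \<open>enat q\<close> is positive and finite, it is a
    maximum.\<close>
  then have "S \<noteq> {}" using q_gt by (auto simp: bot_enat_def zero_enat_def)
  then have "finite S" "Sup S = Max S" using sup by (auto simp: Sup_enat_def split: if_splits)
  then have "enat q \<in> S" using Max_in[of S] \<open>S \<noteq> {}\<close> sup by simp
  then obtain cs where "isometric_cycle V E cs" "length cs = q" by (auto simp: S_def)
  then show ?thesis using isoseq_of_isometric_cycle(1) by metis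
qed

lemma mem_window:
  "v \<in> window c i \<longleftrightarrow> v \<in> V \<and> (gdist V E v (c i) \<le> enat k \<or> gdist V E v (c (i + int \<epsilon>)) \<le> enat k)"
  using gdist_sym_le by (fastforce simp: window_def gball_def)

lemma window_cong:
  assumes "isoseq V E q c" "int q dvd i - j"
  shows "window c i = window c j"
  using isoseqD(3)[OF assms(1), of i j] isoseqD(3)[OF assms(1), of "i + int \<epsilon>" "j + int \<epsilon>"] assms(2)
  by (simp add: window_def)

text \<open>Each unit by which the degree of \<open>c i\<close> exceeds \<open>\<delta>\<close> adds
  at least \<open>S\<close> vertices to the window, and \<open>S\<close> is nonzero since
  \<open>k\<close> is positive. Equality therefore forces the degree.\<close>

lemma card_window_ge:
  assumes c: "isoseq V E q c"
  shows "moore_bound \<delta> g \<le> card (window c i)"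
    "card (window c i) = moore_bound \<delta> g \<Longrightarrow> degree V E (c i) = \<delta>"
proof -
  define S where "S = (\<Sum>i<k. (\<delta> - 1) ^ i)"
  have "S \<noteq> 0" using k_pos by (auto simp: S_def intro!: bexI[of _ 0])
  note cV = isoseqD(1)[OF c] and dge = degree_ge[OF isoseqD(1)[OF c]]
  have *: "moore_bound \<delta> g + (degree V E (c i) - \<delta>) * S \<le> card (window c i)"
  proof (cases "odd g")
    case True
    have "g = 2 * k + 1" by (rule moore_radius_cases(1)[OF True, folded k_def])
    then have "1 + degree V E (c i) * S \<le> card (window c i)"
      using card_gball_ge[OF graph degree_ge cV[of i], of k] True
      by (simp add: girth S_def window_def \<epsilon>_def)
    moreover have "moore_bound \<delta> g = 1 + \<delta> * S"
      using True by (simp add: moore_bound_def k_def[symmetric] S_def sum_distrib_left)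
    moreover have "degree V E (c i) = \<delta> + (degree V E (c i) - \<delta>)" using dge[of i] by simp
    ultimately show ?thesis by (metis add.assoc add_mult_distrib)
  next
    case False
    then have \<epsilon>: "\<epsilon> = 1" by (simp add: \<epsilon>_def)
    then have "g = 2 * k + 2" using g_eq by simp
    then have "2 + ((degree V E (c i) - 1) + (degree V E (c (i + 1)) - 1)) * S \<le> card (window c i)"
      using card_gball_edge_ge[OF graph degree_ge isoseqD(2)[OF c, of i], of k]
      by (simp add: girth S_def window_def \<epsilon>)
    moreover have "moore_bound \<delta> g = 2 + 2 * (\<delta> - 1) * S"
    proof -
      have "(\<Sum>i=1..k. 2 * (\<delta> - 1) ^ i) = (\<Sum>i<k. 2 * (\<delta> - 1) ^ Suc i)"
        by (rule sum.reindex_bij_witness[of _ Suc "\<lambda>i. i - 1"]) auto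
      then show ?thesis using False by (simp add: moore_bound_def k_def[symmetric] S_def sum_distrib_left mult_ac)
    qed
    moreover have "(2 * (\<delta> - 1) + (degree V E (c i) - \<delta>)) * S
        \<le> ((degree V E (c i) - 1) + (degree V E (c (i + 1)) - 1)) * S"
      using dge[of i] dge[of "i + 1"] \<delta>_ge by (intro mult_le_mono1) linarith
    ultimately show ?thesis by (simp add: add_mult_distrib)
  qed
  then show "moore_bound \<delta> g \<le> card (window c i)" by simp
  assume "card (window c i) = moore_bound \<delta> g"
  with * have "(degree V E (c i) - \<delta>) * S = 0" by simp
  then show "degree V E (c i) = \<delta>" using \<open>S \<noteq> 0\<close> dge[of i] by simp
qed

text \<open>The indices of the cycle vertices within distance \<open>k\<close> of \<open>v\<close> differ pairwise by at most \<open>2k\<close>;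
  as \<open>q > 6k\<close>, they lie in a common arc.\<close>

lemma close_arc:
  assumes c: "isoseq V E q c"
  obtains m where "\<And>i. gdist V E v (c i) \<le> enat k \<Longrightarrow> \<exists>x. 0 \<le> x \<and> x \<le> 2 * int k \<and> int q dvd i - m - x"
proof (cases "\<exists>i. gdist V E v (c i) \<le> enat k")
  case True
  then obtain i0 where i0: "gdist V E v (c i0) \<le> enat k" by blast
  have close: "near q (2 * k) i j" if "gdist V E v (c i) \<le> enat k" "gdist V E v (c j) \<le> enat k" for i j
    using isoseqD(4)[OF c gdist_triangle_le[OF gdist_sym_le[OF that(1)] that(2)]] by (simp add: mult_2)
  define X where "X = {x. \<bar>x\<bar> \<le> 2 * int k \<and> gdist V E v (c (i0 + x)) \<le> enat k}"
  have "X \<subseteq> {- 2 * int k..2 * int k}" by (auto simp: X_def)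
  then have "finite X" by (rule finite_subset) simp
  have "0 \<in> X" using i0 by (simp add: X_def)
  define a where "a = Min X"
  have "a \<in> X" unfolding a_def using \<open>finite X\<close> \<open>0 \<in> X\<close> by (intro Min_in) auto
  show ?thesis
  proof (rule that[of "i0 + a"])
    fix i assume i: "gdist V E v (c i) \<le> enat k"
    obtain x where x: "\<bar>x\<bar> \<le> 2 * int k" "int q dvd i - i0 - x"
      using close[OF i0 i] by (auto simp: near_def)
    have "c i = c (i0 + x)" by (rule isoseqD(3)[OF c]) (use x in \<open>simp add: algebra_simps\<close>)
    then have xX: "x \<in> X" using x i by (simp add: X_def)
    then have "a \<le> x" unfolding a_def using \<open>finite X\<close> by simp
    have "near q (2 * k) (i0 + a) (i0 + x)" using close xX \<open>a \<in> X\<close> by (simp add: X_def)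
    then obtain z where z: "\<bar>z\<bar> \<le> 2 * int k" "int q dvd x - a - z" by (auto simp: near_def)
    have a: "\<bar>a\<bar> \<le> 2 * int k" using \<open>a \<in> X\<close> by (simp add: X_def)
    \<comment> \<open>Three terms of size at most \<open>2 * k\<close> each.\<close>
    have "x - a - z = 0"
      by (rule small_dvd_eq_0[OF z(2)]) (use z(1) x(1) a q_gt in linarith)
    then have "x - a \<le> 2 * int k" using z(1) by linarith
    moreover have "int q dvd i - (i0 + a) - (x - a)" using x(2) by (simp add: algebra_simps)
    ultimately show "\<exists>x. 0 \<le> x \<and> x \<le> 2 * int k \<and> int q dvd i - (i0 + a) - x"
      using \<open>a \<le> x\<close> by (intro exI[of _ "x - a"]) auto
  qed
qed (use that in blast)

text \<open>The arc of \<open>2 * k + 1\<close> indices from \<open>close_arc\<close>, lengthened to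
  the left by \<open>\<epsilon>\<close> because a window also looks at
  \<open>c (i + \<epsilon>)\<close>, has exactly \<open>g\<close> indices. If all of them occur, the
  two ends of the arc of close vertices are attained, and \<open>f\<close> is its midpoint
  \<open>m + k\<close>.\<close>

lemma window_index:
  assumes c: "isoseq V E q c" and v: "v \<in> V"
  defines "J \<equiv> {i \<in> {0..<int q}. v \<in> window c i}"
  shows "card J \<le> g"
    "card J = g \<Longrightarrow> \<exists>f. gdist V E v (c (f - int k)) \<le> enat k \<and> gdist V E v (c (f + int k)) \<le> enat k \<and>
      (\<forall>i. v \<in> window c i \<longleftrightarrow> (\<exists>x. - int k - int \<epsilon> \<le> x \<and> x \<le> int k \<and> int q dvd i - f - x))"
proof -
  have q0: "0 < int q" using q_gt by simp
  obtain m where m: "\<And>i. gdist V E v (c i) \<le> enat k \<Longrightarrow>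
      \<exists>x. 0 \<le> x \<and> x \<le> 2 * int k \<and> int q dvd i - m - x"
    using close_arc[OF c] by blast
  define X where "X = {m - int \<epsilon>..m + 2 * int k}"
  have "card X = 2 * k + 1 + \<epsilon>" by (simp add: X_def)
  then have cardX: "card X = g" by (rule trans[OF _ g_eq[symmetric]])
  have arc: "\<exists>y\<in>X. int q dvd i - y" if "v \<in> window c i" for i
  proof -
    from that consider "gdist V E v (c i) \<le> enat k" | "gdist V E v (c (i + int \<epsilon>)) \<le> enat k"
      by (auto simp: mem_window)
    then show ?thesis
    proof cases
      case 1
      then obtain x where "0 \<le> x" "x \<le> 2 * int k" "int q dvd i - m - x" using m by blast
      then show ?thesis by (intro bexI[of _ "m + x"]) (auto simp: X_def algebra_simps)
    next
      case 2
      then obtain x where "0 \<le> x" "x \<le> 2 * int k" "int q dvd i + int \<epsilon> - m - x" using m by blast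
      then show ?thesis by (intro bexI[of _ "m + x - int \<epsilon>"]) (auto simp: X_def algebra_simps)
    qed
  qed
  have sub: "J \<subseteq> (\<lambda>y. y mod int q) ` X"
  proof
    fix i assume i: "i \<in> J"
    then obtain y where "y \<in> X" "int q dvd i - y" using arc by (auto simp: J_def)
    moreover from this i have "i = y mod int q"
      unfolding mod_eq_dvd_iff[symmetric] by (simp add: J_def)
    ultimately show "i \<in> (\<lambda>y. y mod int q) ` X" by blast
  qed
  have fin: "finite X" by (simp add: X_def)
  show "card J \<le> g"
    using card_mono[OF _ sub] card_image_le[OF fin, of "\<lambda>y. y mod int q"] fin cardX by simp
  assume "card J = g"
  then have eq: "J = (\<lambda>y. y mod int q) ` X"
    using card_image_le[OF fin, of "\<lambda>y. y mod int q"] fin cardX by (intro card_seteq sub) auto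
  have inX: "v \<in> window c i" if "y \<in> X" "int q dvd i - y" for i y
  proof -
    have "y mod int q \<in> J" using that(1) eq by blast
    moreover have "int q dvd i - y mod int q"
      using that(2) by (simp add: mod_eq_dvd_iff[symmetric])
    ultimately show ?thesis using window_cong[OF c] by (auto simp: J_def)
  qed
  \<comment> \<open>The leftmost window contains \<open>v\<close> because of \<open>c m\<close> or
    of \<open>c (m - \<epsilon>)\<close>. The latter lies outside the arc of close vertices unless
    \<open>\<epsilon> = 0\<close>, when the two coincide.\<close>
  have left: "gdist V E v (c m) \<le> enat k"
  proof -
    have "v \<in> window c (m - int \<epsilon>)" by (rule inX[of "m - int \<epsilon>"]) (auto simp: X_def)
    moreover have "\<epsilon> = 0" if *: "gdist V E v (c (m - int \<epsilon>)) \<le> enat k"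
    proof -
      obtain x where x: "0 \<le> x" "x \<le> 2 * int k" "int q dvd m - int \<epsilon> - m - x" using m[OF *] by blast
      have "m - int \<epsilon> - m - x = 0" by (rule small_dvd_eq_0[OF x(3)]) (use x \<epsilon>_le q_gt in linarith)
      then show ?thesis using x by simp
    qed
    ultimately show ?thesis by (auto simp: mem_window)
  qed
  have right: "gdist V E v (c (m + 2 * int k)) \<le> enat k"
  proof -
    have "v \<in> window c (m + 2 * int k)" by (rule inX[of "m + 2 * int k"]) (auto simp: X_def)
    moreover have "\<epsilon> = 0" if *: "gdist V E v (c (m + 2 * int k + int \<epsilon>)) \<le> enat k"
    proof -
      obtain x where x: "0 \<le> x" "x \<le> 2 * int k" "int q dvd m + 2 * int k + int \<epsilon> - m - x"
        using m[OF *] by blast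
      have "m + 2 * int k + int \<epsilon> - m - x = 0"
        by (rule small_dvd_eq_0[OF x(3)]) (use x \<epsilon>_le q_gt in linarith)
      then show ?thesis using x by simp
    qed
    ultimately show ?thesis by (auto simp: mem_window)
  qed
  have "v \<in> window c i \<longleftrightarrow>
      (\<exists>x. - int k - int \<epsilon> \<le> x \<and> x \<le> int k \<and> int q dvd i - (m + int k) - x)" for i
  proof
    assume "v \<in> window c i"
    then obtain y where "y \<in> X" "int q dvd i - y" using arc by blast
    then show "\<exists>x. - int k - int \<epsilon> \<le> x \<and> x \<le> int k \<and> int q dvd i - (m + int k) - x"
      by (intro exI[of _ "y - m - int k"]) (auto simp: X_def algebra_simps)
  next
    assume "\<exists>x. - int k - int \<epsilon> \<le> x \<and> x \<le> int k \<and> int q dvd i - (m + int k) - x"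
    then obtain x where "- int k - int \<epsilon> \<le> x" "x \<le> int k" "int q dvd i - (m + int k) - x" by blast
    then show "v \<in> window c i"
      by (intro inX[of "m + int k + x"]) (auto simp: X_def algebra_simps)
  qed
  then show "\<exists>f. gdist V E v (c (f - int k)) \<le> enat k \<and> gdist V E v (c (f + int k)) \<le> enat k \<and>
      (\<forall>i. v \<in> window c i \<longleftrightarrow> (\<exists>x. - int k - int \<epsilon> \<le> x \<and> x \<le> int k \<and> int q dvd i - f - x))"
    using left right by (intro exI[of _ "m + int k"]) (simp add: algebra_simps)
qed

lemma double_count:
  assumes c: "isoseq V E q c"
  shows "card (window c i) = moore_bound \<delta> g"
    "v \<in> V \<Longrightarrow> card {i \<in> {0..<int q}. v \<in> window c i} = g"
proof -
  let ?I = "{0..<int q}" and ?M = "moore_bound \<delta> g"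
  let ?J = "\<lambda>v. {i \<in> ?I. v \<in> window c i}"
  have win: "window c i = {v \<in> V. v \<in> window c i}" for i by (auto simp: mem_window)
  have count: "(\<Sum>i\<in>?I. card (window c i)) = (\<Sum>v\<in>V. card (?J v))"
    by (subst win) (rule sum_multicount_gen, use finV in auto)
  have low: "(\<Sum>i\<in>?I. ?M) \<le> (\<Sum>i\<in>?I. card (window c i))"
    by (intro sum_mono card_window_ge(1)[OF c])
  have up: "(\<Sum>v\<in>V. card (?J v)) \<le> (\<Sum>v\<in>V. g)"
    by (intro sum_mono window_index(1)[OF c])
  have tot: "(\<Sum>i\<in>?I. ?M) = (\<Sum>v\<in>V. g)" using card_V by simp
  have "(\<Sum>i\<in>?I. ?M) = (\<Sum>i\<in>?I. card (window c i))" using count low up tot by linarith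
  then have *: "?M = card (window c i)" if "i \<in> ?I" for i
    by (rule sum_mono_inv[OF _ _ that]) (auto simp: card_window_ge(1)[OF c])
  have "i mod int q \<in> ?I" using q_gt by simp
  moreover have "window c i = window c (i mod int q)"
    by (rule window_cong[OF c]) (simp add: mod_eq_dvd_iff[symmetric])
  ultimately show "card (window c i) = ?M" using * by simp
  assume "v \<in> V"
  have "(\<Sum>v\<in>V. card (?J v)) = (\<Sum>v\<in>V. g)" using count low up tot by linarith
  then show "card (?J v) = g"
    by (rule sum_mono_inv[OF _ window_index(1)[OF c] \<open>v \<in> V\<close> finV])
qed

lemma degree_isoseq: "isoseq V E q c \<Longrightarrow> degree V E (c i) = \<delta>"
  using card_window_ge(2) double_count(1) by blast

text \<open>Values of \<open>f\<close> matter only modulo \<open>q\<close>. The two distance bounds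
  locate \<open>v\<close>; the window condition is what later turns a window into a union of fibres.
  Its range is asymmetric because the second ball of a window is centred \<open>\<epsilon>\<close>
  steps ahead.\<close>

definition centre :: "(int \<Rightarrow> 'a) \<Rightarrow> ('a \<Rightarrow> int) \<Rightarrow> bool" where
  "centre c f \<longleftrightarrow> (\<forall>v\<in>V. gdist V E v (c (f v - int k)) \<le> enat k \<and> gdist V E v (c (f v + int k)) \<le> enat k \<and>
      (\<forall>i. v \<in> window c i \<longleftrightarrow> (\<exists>x. - int k - int \<epsilon> \<le> x \<and> x \<le> int k \<and> int q dvd i - f v - x)))"

lemma centre_exists:
  assumes "isoseq V E q c"
  shows "\<exists>f. centre c f"
  unfolding centre_def
  by (intro bchoice ballI window_index(2)[OF assms] double_count(2)[OF assms])

lemma centreD: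
  assumes "centre c f" "v \<in> V"
  shows "gdist V E v (c (f v - int k)) \<le> enat k" "gdist V E v (c (f v + int k)) \<le> enat k"
    "v \<in> window c i \<longleftrightarrow> (\<exists>x. - int k - int \<epsilon> \<le> x \<and> x \<le> int k \<and> int q dvd i - f v - x)"
  using assms by (auto simp: centre_def)

text \<open>If \<open>x\<close> is the displacement of the centres, comparing opposite extreme cycle
  vertices yields the displacements \<open>y = x - 2 * k\<close> and \<open>z = x + 2 * k\<close>.
  All are at most \<open>2 * k + 1\<close> in size, which leaves only \<open>-1\<close>,
  \<open>0\<close> and \<open>1\<close> for \<open>x\<close>.\<close>

lemma centre_edge:
  assumes c: "isoseq V E q c" and f: "centre c f" and uv: "u \<in> V" "v \<in> V" "{u, v} \<in> E"
  shows "near q 1 (f u) (f v)"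
proof -
  have near: "near q (2 * k + 1) i j"
    if "gdist V E u (c i) \<le> enat k" "gdist V E v (c j) \<le> enat k" for i j
  proof -
    have "gdist V E (c i) v \<le> enat (k + 1)"
      using gdist_triangle_le[OF gdist_sym_le[OF that(1)] gdist_edge_le[OF uv]] .
    from gdist_triangle_le[OF this that(2)] have "gdist V E (c i) (c j) \<le> enat (2 * k + 1)"
      by (simp add: mult_2)
    then show ?thesis by (rule isoseqD(4)[OF c])
  qed
  note u = centreD(1,2)[OF f uv(1)] and v = centreD(1,2)[OF f uv(2)]
  obtain x where x: "\<bar>x\<bar> \<le> int (2 * k + 1)" "int q dvd (f v + int k) - (f u + int k) - x"
    using near[OF u(2) v(2)] by (rule nearE)
  obtain y where y: "\<bar>y\<bar> \<le> int (2 * k + 1)" "int q dvd (f v - int k) - (f u + int k) - y"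
    using near[OF u(2) v(1)] by (rule nearE)
  obtain z where z: "\<bar>z\<bar> \<le> int (2 * k + 1)" "int q dvd (f v + int k) - (f u - int k) - z"
    using near[OF u(1) v(2)] by (rule nearE)
  have "int q dvd 2 * int k + y - x" using dvd_diff[OF x(2) y(2)] by (simp add: algebra_simps)
  then have "2 * int k + y - x = 0" by (rule small_dvd_eq_0) (use x y q_gt in linarith)
  moreover have "int q dvd 2 * int k + x - z" using dvd_diff[OF z(2) x(2)] by (simp add: algebra_simps)
  then have "2 * int k + x - z = 0" by (rule small_dvd_eq_0) (use x z q_gt in linarith)
  ultimately have "\<bar>x\<bar> \<le> 1" using y z by linarith
  then show ?thesis using x(2) by (intro nearI[of x]) auto
qed

lemma centre_gdist:
  assumes "isoseq V E q c" "centre c f" "gdist V E u v \<le> enat n"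
  shows "near q n (f u) (f v)"
  using centre_edge[OF assms(1,2)] assms(3) by (rule near_of_gdist_le)

lemma centre_cycle:
  assumes c: "isoseq V E q c" and f: "centre c f"
  shows "int q dvd f (c j) - j"
proof (rule near_squeeze[of q k])
  note d = centreD(1,2)[OF f isoseqD(1)[OF c, of j]]
  show "near q k j (f (c j) - int k)" "near q k j (f (c j) + int k)"
    using d by (auto intro: isoseqD(4)[OF c])
  show "4 * k < q" using q_gt by simp
qed

text \<open>Vertex \<open>v\<close> lies on a path of length \<open>2k\<close> between the cycle vertices with indices \<open>f v - k\<close> and
  \<open>f v + k\<close>. As \<open>f\<close> is 1-Lipschitz, it increases by exactly one along each edge of that path, so
  rerouting the cycle through the path keeps it isometric.\<close>

lemma reroute:
  assumes c: "isoseq V E q c" and f: "centre c f" and v: "v \<in> V"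
  shows "\<exists>c'. isoseq V E q c' \<and> c' (f v) = v \<and> (\<forall>j. int q dvd f (c' j) - j)"
proof -
  have q0: "0 < int q" using q_gt by simp
  note lip = centre_gdist[OF c f] and fc = centre_cycle[OF c f]
  define a where "a = f v - int k"
  obtain m h where h: "m \<le> k" "h 0 = c a" "h m = v" "\<forall>i\<le>m. h i \<in> V" "\<forall>i<m. {h i, h (Suc i)} \<in> E"
    using gdist_sym_le[OF centreD(1)[OF f v]] by (auto simp: gdist_le_iff a_def)
  obtain m' h' where h': "m' \<le> k" "h' 0 = v" "h' m' = c (a + 2 * int k)" "\<forall>i\<le>m'. h' i \<in> V"
      "\<forall>i<m'. {h' i, h' (Suc i)} \<in> E"
    using centreD(2)[OF f v] by (auto simp: gdist_le_iff a_def algebra_simps)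
  \<comment> \<open>On the isometric cycle the two ends are \<open>2 * k\<close> apart, so neither
    half can be shorter than \<open>k\<close>.\<close>
  have full: "m = k \<and> m' = k"
  proof -
    have "gdist V E (c a) v \<le> enat m" "gdist V E v (c (a + 2 * int k)) \<le> enat m'"
      using h h' unfolding gdist_le_iff by blast+
    from gdist_triangle_le[OF this] have "near q (m + m') a (a + 2 * int k)" by (rule isoseqD(4)[OF c])
    then obtain x where x: "\<bar>x\<bar> \<le> int (m + m')" "int q dvd 2 * int k - x" by (auto simp: near_def)
    have "2 * int k - x = 0" by (rule small_dvd_eq_0[OF x(2)]) (use x(1) h(1) h'(1) q_gt in linarith)
    then show ?thesis using x(1) h(1) h'(1) by linarith
  qed
  obtain p where p: "\<And>i. i \<le> k \<Longrightarrow> p i = h i" "p (k + k) = h' k"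
      "\<forall>i\<le>k + k. p i \<in> V" "\<forall>i<k + k. {p i, p (Suc i)} \<in> E"
    using walk_concat[of k h V E k h'] h h' full by auto
  have p0: "p 0 = c a" using p(1)[of 0] h(2) by simp
  have pk: "p k = v" using p(1)[of k] h(3) full by simp
  have p2k: "p (2 * k) = c (a + 2 * int k)" using p(2) h'(3) full unfolding mult_2[of k] by metis
  \<comment> \<open>\<open>p t\<close> is within \<open>t\<close> of one end and within
    \<open>2 * k - t\<close> of the other, so the Lipschitz property leaves only one value of
    \<open>f\<close>.\<close>
  have fp: "int q dvd f (p t) - (a + int t)" if "t \<le> 2 * k" for t
  proof -
    have "gdist V E (p 0) (p t) \<le> enat t"
      unfolding gdist_le_iff using p(3,4) that by (intro exI[of _ t] exI[of _ p]) auto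
    then have "near q t (f (c a)) (f (p t))" using lip p0 by simp
    then have "near q t a (f (p t))" by (rule near_cong) (use fc[of a] in \<open>simp_all add: dvd_diff_commute\<close>)
    then obtain x where x: "\<bar>x\<bar> \<le> int t" "int q dvd f (p t) - a - x" by (auto simp: near_def)
    have "gdist V E (p t) (p (2 * k)) \<le> enat (2 * k - t)"
      unfolding gdist_le_iff using p(3,4) that
      by (intro exI[of _ "2 * k - t"] exI[of _ "\<lambda>i. p (t + i)"]) auto
    then have "near q (2 * k - t) (f (p t)) (f (c (a + 2 * int k)))" using lip p2k by simp
    then have "near q (2 * k - t) (f (p t)) (a + 2 * int k)"
      by (rule near_cong) (use fc[of "a + 2 * int k"] in \<open>simp_all add: dvd_diff_commute\<close>)
    then obtain y where y: "\<bar>y\<bar> \<le> int (2 * k - t)" "int q dvd a + 2 * int k - f (p t) - y"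
      by (auto simp: near_def)
    have "int q dvd 2 * int k - x - y" using dvd_add[OF x(2) y(2)] by (simp add: algebra_simps)
    then have "2 * int k - x - y = 0" by (rule small_dvd_eq_0) (use x y that q_gt in linarith)
    then have "x = int t" using x y that by linarith
    then show ?thesis using x by (simp add: algebra_simps)
  qed
  \<comment> \<open>The offset of index \<open>j\<close> from \<open>a\<close>, reduced to
    \<open>0..<q\<close>; offsets up to \<open>2 * k\<close> follow the path, the others the old
    cycle.\<close>
  define t where "t j = nat ((j - a) mod int q)" for j
  define c' where "c' j = (if t j \<le> 2 * k then p (t j) else c j)" for j
  have t_dvd: "int q dvd j - (a + int (t j))" for j
  proof -
    have "int (t j) = (j - a) mod int q" using q0 by (simp add: t_def)
    then have "j - (a + int (t j)) = (j - a) - (j - a) mod int q" by simp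
    then show ?thesis by (metis dvd_minus_mod)
  qed
  have t_cong: "t i = t j" if "int q dvd i - j" for i j
  proof -
    have "int q dvd (i - a) - (j - a)" using that by simp
    then show ?thesis unfolding t_def mod_eq_dvd_iff[symmetric] by simp
  qed
  have t_suc: "t (j + 1) = (if Suc (t j) < q then Suc (t j) else 0)" for j
  proof -
    define r where "r = (j - a) mod int q"
    have r: "0 \<le> r" "r < int q" "t j = nat r" using q0 by (auto simp: r_def t_def)
    have "(j + 1 - a) mod int q = (r + 1) mod int q"
      unfolding r_def mod_add_left_eq by (simp add: add_diff_eq add.commute)
    moreover have "(r + 1) mod int q = (if r + 1 < int q then r + 1 else 0)"
    proof (cases "r + 1 < int q")
      case False
      then have "r + 1 = int q" using r by linarith
      then show ?thesis by simp
    qed (use r in simp)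
    ultimately show ?thesis using r by (auto simp: t_def nat_add_distrib nat_less_iff)
  qed
  have c'_c: "c' j = c j" if "t j = 0 \<or> 2 * k \<le> t j" for j
  proof -
    have "c (a + int (t j)) = c j" using t_dvd[of j] by (intro isoseqD(3)[OF c]) (simp add: dvd_diff_commute)
    then show ?thesis using that p0 p2k by (auto simp: c'_def)
  qed
  have c'V: "c' j \<in> V" for j using p(3) isoseqD(1)[OF c] by (auto simp: c'_def mult_2)
  have c'E: "{c' j, c' (j + 1)} \<in> E" for j
  proof (cases "t j < 2 * k")
    case True
    then have "t (j + 1) = Suc (t j)" using q_gt by (simp add: t_suc)
    then show ?thesis using True p(4) by (simp add: c'_def mult_2)
  next
    case False
    then have "c' j = c j" "c' (j + 1) = c (j + 1)" by (auto intro!: c'_c simp: t_suc)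
    then show ?thesis using isoseqD(2)[OF c] by simp
  qed
  have c'_cong: "c' i = c' j" if "int q dvd i - j" for i j
    using t_cong[OF that] isoseqD(3)[OF c that] by (simp add: c'_def)
  have fc': "int q dvd f (c' j) - j" for j
  proof (cases "t j \<le> 2 * k")
    case True
    then have "int q dvd (f (p (t j)) - (a + int (t j))) - (j - (a + int (t j)))"
      using fp t_dvd by (blast intro: dvd_diff)
    then show ?thesis using True by (simp add: c'_def)
  qed (use fc in \<open>simp add: c'_def\<close>)
  \<comment> \<open>\<open>f\<close> is a Lipschitz left inverse of \<open>c'\<close> modulo
    \<open>q\<close>; hence \<open>c'\<close> admits no shortcuts.\<close>
  have "near q n i j" if "gdist V E (c' i) (c' j) \<le> enat n" for i j n
    using lip[OF that] by (rule near_cong) (use fc' in \<open>simp_all add: dvd_diff_commute\<close>)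
  then have "isoseq V E q c'"
    using c'V c'E c'_cong by (simp add: isoseq_def)
  moreover have "t (f v) = k" using q_gt by (simp add: t_def a_def)
  then have "c' (f v) = v" using pk by (simp add: c'_def)
  ultimately show ?thesis using fc' by blast
qed

end

section \<open>Layers\<close>

text \<open>An integer-valued 1-Lipschitz function modulo \<open>q\<close> has winding number \<open>0\<close> or \<open>\<plusminus>1\<close> along a
  closed walk of length \<open>q\<close>. In the first case its values along the walk lie in an interval of length
  at most \<open>q / 2\<close>, which is not \<open>k\<close>-dense modulo \<open>q\<close>; in the second case every step is \<open>1\<close>, or every
  step is \<open>-1\<close>.\<close>

lemma winding:
  fixes h :: "int \<Rightarrow> int"
  assumes per: "\<And>i j. int q dvd i - j \<Longrightarrow> h i = h j"
    and lip: "\<And>i. near q 1 (h i) (h (i + 1))"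
    and dense: "\<And>i. \<exists>j. near q k i (h j)"
    and q: "4 * k + 2 < q"
  shows "\<exists>\<sigma> r. (\<sigma> = 1 \<or> \<sigma> = -1) \<and> (\<forall>j. int q dvd h j - (r + \<sigma> * j))"
proof -
  have "\<forall>i. \<exists>x. \<bar>x\<bar> \<le> 1 \<and> int q dvd h (i + 1) - h i - x"
    using lip by (auto simp: near_def)
  then obtain s where s: "\<And>i. \<bar>s i\<bar> \<le> 1" "\<And>i. int q dvd h (i + 1) - h i - s i" by metis
  \<comment> \<open>A lift of \<open>h\<close> to the integers along one period; below,
    \<open>d\<close> is its winding number.\<close>
  define F where "F n = h 0 + (\<Sum>i<n. s (int i))" for n
  have F_Suc: "F (Suc n) = F n + s (int n)" for n by (simp add: F_def)
  have hF: "int q dvd h (int n) - F n" for n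
  proof (induction n)
    case (Suc n)
    have "h (int (Suc n)) = h (int n + 1)" by (simp add: add.commute)
    then have "h (int (Suc n)) - F (Suc n) = (h (int n) - F n) + (h (int n + 1) - h (int n) - s (int n))"
      by (simp add: F_Suc)
    then show ?case using dvd_add[OF Suc s(2)[of "int n"]] by metis
  qed (simp add: F_def)
  have red: "\<exists>n<q. h j = h (int n) \<and> int q dvd j - int n" for j
    using q per[of j "j mod int q"]
    by (intro exI[of _ "nat (j mod int q)"]) (auto simp: nat_less_iff dvd_minus_mod)
  have "h (int q) = h 0" by (rule per) simp
  then have "int q dvd F q - F 0" using dvd_diff[OF hF[of 0] hF[of q]] by (simp add: F_def)
  then obtain d where d: "F q - F 0 = int q * d" by (auto elim: dvdE)
  have diff: "\<bar>F (m + n) - F m\<bar> \<le> int n" for m n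
  proof (induction n)
    case (Suc n)
    then show ?case using F_Suc[of "m + n"] s(1)[of "int (m + n)"] by simp
  qed simp
  have const: ?thesis if \<sigma>: "\<sigma> = 1 \<or> \<sigma> = -1" and F: "F q - F 0 = int q * \<sigma>" for \<sigma>
  proof -
    \<comment> \<open>Winding once in \<open>q\<close> steps leaves no slack: the terms are
      nonnegative and sum to zero.\<close>
    have "(\<Sum>i<q. 1 - \<sigma> * s (int i)) = int q - \<sigma> * (F q - F 0)"
      by (simp add: F_def sum_subtractf sum_distrib_left)
    also have "\<dots> = 0" using \<sigma> F by auto
    finally have "\<forall>i<q. 1 - \<sigma> * s (int i) = 0"
      using \<sigma> s(1) by (subst (asm) sum_nonneg_eq_0_iff) (auto simp: abs_le_iff)
    then have step: "s (int i) = \<sigma>" if "i < q" for i using that \<sigma> by auto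
    have "n \<le> q \<Longrightarrow> F n = h 0 + \<sigma> * int n" for n
      by (induction n) (auto simp: F_Suc step algebra_simps, simp add: F_def)
    then have hn: "int q dvd h (int n) - (h 0 + \<sigma> * int n)" if "n < q" for n
      using hF[of n] that by simp
    have "int q dvd h j - (h 0 + \<sigma> * j)" for j
    proof -
      obtain n where n: "n < q" "h j = h (int n)" "int q dvd j - int n" using red by blast
      have "int q dvd (h (int n) - (h 0 + \<sigma> * int n)) - \<sigma> * (j - int n)"
        by (intro dvd_diff hn n dvd_mult)
      then show ?thesis using n(2) by (simp add: algebra_simps)
    qed
    with \<sigma> show ?thesis by blast
  qed
  have "\<bar>int q * d\<bar> \<le> int q" using diff[of 0 q] d by simp
  then have "\<bar>d\<bar> \<le> 1" using q by (simp add: abs_mult)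
  then consider "d = 1" | "d = -1" | "d = 0" by linarith
  then show ?thesis
  proof cases
    case 3
    define M where "M = Max (F ` {..q})"
    have "M \<in> F ` {..q}" unfolding M_def by (intro Max_in) auto
    then obtain a where a: "a \<le> q" "F a = M" by auto
    have upper: "F b \<le> M" if "b \<le> q" for b using that by (auto simp: M_def)
    \<comment> \<open>The closed walk joins \<open>a\<close> and \<open>b\<close> along two arcs of
      total length \<open>q\<close>, and the drop from \<open>M\<close> is at most the length of
      each.\<close>
    have lower: "2 * (M - F b) \<le> int q" if "b \<le> q" for b
    proof (cases "a \<le> b")
      case True
      then show ?thesis
        using diff[of a "b - a"] diff[of b "q - b"] diff[of 0 a] a that d 3 by auto
    next
      case False
      then show ?thesis
        using diff[of b "a - b"] diff[of a "q - a"] diff[of 0 b] a that d 3 by auto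
    qed
    \<comment> \<open>A residue just more than \<open>k\<close> above the maximum. Reaching it from
      below through wrap-around would need \<open>q \<le> q / 2 + 2 * k + 1\<close>, against
      \<open>4 * k + 2 < q\<close>.\<close>
    obtain j where j: "near q k (M + int k + 1) (h j)" using dense by blast
    obtain b where b: "b < q" "h j = h (int b)" using red by blast
    have "near q k (M + int k + 1) (F b)"
      using j by (rule near_cong) (use hF[of b] b in \<open>simp_all add: dvd_diff_commute\<close>)
    then obtain x where x: "\<bar>x\<bar> \<le> int k" "int q dvd F b - (M + int k + 1) - x" by (rule nearE)
    have "F b \<le> M" "2 * (M - F b) \<le> int q" using upper[of b] lower[of b] b by simp_all
    moreover have "4 * int k + 2 < int q" using q by simp
    moreover have "- int k \<le> x" "x \<le> int k" using x(1) by linarith+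
    ultimately have "\<bar>F b - (M + int k + 1) - x\<bar> < int q" by (simp add: abs_less_iff)
    with x(2) have "F b - (M + int k + 1) - x = 0" by (rule small_dvd_eq_0)
    then show ?thesis using x(1) upper[of b] b by simp
  qed (use const[of 1] const[of "-1"] d in auto)
qed

context equatorial
begin

section \<open>The fibres of a fixed centre function\<close>

context
  fixes c :: "int \<Rightarrow> 'a" and f :: "'a \<Rightarrow> int"
  assumes c: "isoseq V E q c" and f: "centre c f"
begin

definition layer :: "int \<Rightarrow> 'a set" where
  "layer i = {v \<in> V. int q dvd f v - i}"

lemma cycle_in_layer: "c i \<in> layer i"
  using isoseqD(1)[OF c] centre_cycle[OF c f] by (simp add: layer_def)

lemma layer_cong:
  assumes "int q dvd i - j"
  shows "layer i = layer j"
proof -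
  have "int q dvd f v - i \<longleftrightarrow> int q dvd f v - j" for v
    using dvd_add_left_iff[OF assms, of "f v - i"] by simp
  then show ?thesis by (simp add: layer_def)
qed

lemma in_layer_unique: "v \<in> layer i \<Longrightarrow> v \<in> layer j \<Longrightarrow> int q dvd i - j"
  using dvd_diff[of "int q" "f v - j" "f v - i"] by (simp add: layer_def)

lemma layer_partition: "cyclic_partition V q layer"
proof -
  have small: "i = j" if "i \<in> {0..<int q}" "j \<in> {0..<int q}" "int q dvd i - j" for i j
    using small_dvd_eq_0[OF that(3)] that by auto
  have "layer (j + int q) = layer j" for j by (rule layer_cong) simp
  moreover have "inj_on layer {0..<int q}"
    using small in_layer_unique cycle_in_layer by (metis inj_onI)
  moreover have "partition_on V (layer ` {0..<int q})"
  proof (rule partition_onI)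
    show "{} \<notin> layer ` {0..<int q}" using cycle_in_layer by auto
    show "\<Union> (layer ` {0..<int q}) = V"
    proof
      show "V \<subseteq> \<Union> (layer ` {0..<int q})"
      proof
        fix v assume "v \<in> V"
        then have "v \<in> layer (f v mod int q)" by (simp add: layer_def dvd_minus_mod)
        then show "v \<in> \<Union> (layer ` {0..<int q})" using q_gt by auto
      qed
    qed (auto simp: layer_def)
    show "disjnt p p'" if "p \<in> layer ` {0..<int q}" "p' \<in> layer ` {0..<int q}" "p \<noteq> p'" for p p'
      using that small in_layer_unique unfolding disjnt_def by blast
  qed
  ultimately show ?thesis by (simp add: cyclic_partition_def)
qed

lemma layer_near: "u \<in> layer i \<Longrightarrow> v \<in> layer j \<Longrightarrow> gdist V E u v \<le> enat n \<Longrightarrow> near q n i j"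
  using near_cong[OF centre_gdist[OF c f]] by (auto simp: layer_def dvd_diff_commute)

lemma layer_reroute:
  assumes "u \<in> layer i"
  obtains c' where "isoseq V E q c'" "c' i = u" "\<And>j. c' j \<in> layer j"
proof -
  obtain c' where c': "isoseq V E q c'" "c' (f u) = u" "\<And>j. int q dvd f (c' j) - j"
    using reroute[OF c f, of u] assms by (auto simp: layer_def)
  show thesis
  proof
    show "c' i = u" using isoseqD(3)[OF c'(1), of i "f u"] c'(2) assms by (simp add: layer_def dvd_diff_commute)
    show "c' j \<in> layer j" for j using isoseqD(1)[OF c'(1)] c'(3) by (simp add: layer_def)
  qed (rule c'(1))
qed

text \<open>The counting applies afresh to \<open>c'\<close> and gives \<open>u\<close> a centre
  \<open>f' u\<close> there. The cycle vertices \<open>c' (f' u \<plusminus> k)\<close> lie in the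
  layers with the same indices, so the squeeze makes \<open>f' u\<close> agree with \<open>i\<close>
  modulo \<open>q\<close>.\<close>

lemma layer_section_gdist:
  assumes c': "isoseq V E q c'" "\<And>j. c' j \<in> layer j" and u: "u \<in> layer i"
  shows "gdist V E u (c' (i - int k)) \<le> enat k" "gdist V E u (c' (i + int k)) \<le> enat k"
proof -
  have uV: "u \<in> V" using u by (simp add: layer_def)
  obtain f' where f': "centre c' f'" using centre_exists[OF c'(1)] by blast
  note d = centreD(1,2)[OF f' uV]
  have "int q dvd f' u - i"
    by (rule near_squeeze[of q k]) (use layer_near[OF u c'(2) d(1)] layer_near[OF u c'(2) d(2)] q_gt in simp_all)
  then have "c' (f' u - int k) = c' (i - int k)" "c' (f' u + int k) = c' (i + int k)"
    by (auto intro!: isoseqD(3)[OF c'(1)])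
  then show "gdist V E u (c' (i - int k)) \<le> enat k" "gdist V E u (c' (i + int k)) \<le> enat k"
    using d by simp_all
qed

text \<open>For the first inclusion, \<open>v\<close> and \<open>w\<close> are each placed on a
  cycle that meets every layer \<open>j\<close> at index \<open>j\<close>; the converse is the
  squeeze between their layers.\<close>

lemma layer_eq_Int:
  assumes v: "v \<in> layer (i - int k)" and w: "w \<in> layer (i + int k)"
  shows "layer i = gball V E k v \<inter> gball V E k w"
proof
  show "layer i \<subseteq> gball V E k v \<inter> gball V E k w"
  proof
    fix u assume u: "u \<in> layer i"
    obtain a where a: "isoseq V E q a" "a (i - int k) = v" "\<And>j. a j \<in> layer j"
      using layer_reroute[OF v] by blast
    obtain b where b: "isoseq V E q b" "b (i + int k) = w" "\<And>j. b j \<in> layer j"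
      using layer_reroute[OF w] by blast
    have "gdist V E v u \<le> enat k" "gdist V E w u \<le> enat k"
      using layer_section_gdist(1)[OF a(1,3) u] layer_section_gdist(2)[OF b(1,3) u] a(2) b(2)
      by (auto intro: gdist_sym_le)
    then show "u \<in> gball V E k v \<inter> gball V E k w" using u by (simp add: gball_def layer_def)
  qed
  show "gball V E k v \<inter> gball V E k w \<subseteq> layer i"
  proof
    fix u assume u: "u \<in> gball V E k v \<inter> gball V E k w"
    then have ul: "u \<in> layer (f u)" by (auto simp: gball_def layer_def)
    have "int q dvd i - f u"
    proof (rule near_squeeze[of q k])
      show "near q k (f u) (i - int k)" "near q k (f u) (i + int k)"
        using u layer_near[OF ul v] layer_near[OF ul w] by (auto simp: gball_def intro: gdist_sym_le)
      show "4 * k < q" using q_gt by simp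
    qed
    then show "u \<in> layer i" using ul by (simp add: layer_def dvd_diff_commute)
  qed
qed

text \<open>\<open>c'\<close> need not be aligned with the layers, so \<open>winding\<close> is
  needed. Its density condition holds since every \<open>c i\<close> is within \<open>k\<close> of
  some vertex of \<open>c'\<close>, by the centre function of \<open>c'\<close> itself.\<close>

lemma layer_meets_cycle:
  assumes c': "isoseq V E q c'"
  shows "\<exists>!v. v \<in> range c' \<and> v \<in> layer j"
proof -
  obtain f' where f': "centre c' f'" using centre_exists[OF c'] by blast
  note c'V = isoseqD(1)[OF c']
  have "\<exists>\<sigma> r. (\<sigma> = 1 \<or> \<sigma> = -1) \<and> (\<forall>j. int q dvd f (c' j) - (r + \<sigma> * j))"
  proof (rule winding[of q "\<lambda>j. f (c' j)" k])
    show "f (c' i) = f (c' j)" if "int q dvd i - j" for i j using isoseqD(3)[OF c' that] by simp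
    show "near q 1 (f (c' i)) (f (c' (i + 1)))" for i
      by (rule centre_edge[OF c f c'V c'V isoseqD(2)[OF c']])
    show "\<exists>j. near q k i (f (c' j))" for i
    proof -
      have "gdist V E (c i) (c' (f' (c i) + int k)) \<le> enat k"
        by (rule centreD(2)[OF f' isoseqD(1)[OF c]])
      then have "near q k (f (c i)) (f (c' (f' (c i) + int k)))" by (rule centre_gdist[OF c f])
      then have "near q k i (f (c' (f' (c i) + int k)))"
        by (rule near_cong) (use centre_cycle[OF c f, of i] in \<open>simp_all add: dvd_diff_commute\<close>)
      then show ?thesis by blast
    qed
  qed (use q_gt in auto)
  then obtain \<sigma> r where \<sigma>: "\<sigma> = 1 \<or> \<sigma> = -1" and fr: "\<And>j. int q dvd f (c' j) - (r + \<sigma> * j)"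
    by blast
  have iff: "c' i \<in> layer j \<longleftrightarrow> int q dvd r + \<sigma> * i - j" for i
    using dvd_add[OF fr[of i], of "r + \<sigma> * i - j"] dvd_diff[OF _ fr[of i], of "f (c' i) - j"] c'V
    by (auto simp: layer_def algebra_simps)
  \<comment> \<open>The solution of \<open>r + \<sigma> * i = j\<close>, as \<open>\<sigma>\<close>
    is its own inverse.\<close>
  have "c' (\<sigma> * (j - r)) \<in> layer j" unfolding iff using \<sigma> by auto
  moreover have "v = c' (\<sigma> * (j - r))" if "v \<in> range c'" "v \<in> layer j" for v
  proof -
    obtain i where i: "v = c' i" using \<open>v \<in> range c'\<close> by blast
    then have "int q dvd \<sigma> * (r + \<sigma> * i - j)" using that(2) iff by simp
    then have "int q dvd i - \<sigma> * (j - r)" using \<sigma> by (auto simp: algebra_simps)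
    then show ?thesis using isoseqD(3)[OF c'] i by simp
  qed
  ultimately show ?thesis by (intro ex1I[of _ "c' (\<sigma> * (j - r))"]) simp_all
qed

text \<open>The window at \<open>i\<close> is the union of the layers from \<open>i - k\<close> to
  \<open>i + k + \<epsilon>\<close>, which are \<open>g\<close> in number; hence the index
  \<open>j + k\<close>.\<close>

lemma sum_layers: "(\<Sum>t<g. card (layer (j + int t))) = moore_bound \<delta> g"
proof -
  have "(\<Union>t<g. layer (j + int t)) = window c (j + int k)"
  proof (intro set_eqI iffI)
    fix v assume "v \<in> (\<Union>t<g. layer (j + int t))"
    then obtain t where t: "t < g" "v \<in> V" "int q dvd f v - (j + int t)" by (auto simp: layer_def)
    have "int t \<le> 2 * int k + int \<epsilon>" using t(1) g_eq by linarith
    moreover have "int q dvd j + int k - f v - (int k - int t)"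
      using t(3) dvd_minus_iff[of "int q" "f v - (j + int t)"] by (simp add: algebra_simps)
    ultimately show "v \<in> window c (j + int k)"
      unfolding centreD(3)[OF f t(2)] by (intro exI[of _ "int k - int t"]) auto
  next
    fix v assume v: "v \<in> window c (j + int k)"
    then have vV: "v \<in> V" by (simp add: mem_window)
    obtain x where x: "- int k - int \<epsilon> \<le> x" "x \<le> int k" "int q dvd j + int k - f v - x"
      using v unfolding centreD(3)[OF f vV] by blast
    define t where "t = nat (int k - x)"
    have t: "int t = int k - x" using x(2) by (simp add: t_def)
    then have "t < g" using x(1) g_eq by linarith
    moreover have "int q dvd f v - (j + int t)"
      using x(3) dvd_minus_iff[of "int q" "j + int k - f v - x"] by (simp add: t algebra_simps)
    ultimately show "v \<in> (\<Union>t<g. layer (j + int t))" using vV by (auto simp: layer_def)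
  qed
  moreover have "card (\<Union>t<g. layer (j + int t)) = (\<Sum>t<g. card (layer (j + int t)))"
  proof (rule card_UN_disjoint)
    show "\<forall>t\<in>{..<g}. finite (layer (j + int t))" using finV by (simp add: layer_def)
    show "\<forall>t\<in>{..<g}. \<forall>t'\<in>{..<g}. t \<noteq> t' \<longrightarrow> layer (j + int t) \<inter> layer (j + int t') = {}"
    proof (intro ballI impI, rule ccontr)
      fix t t' assume t: "t \<in> {..<g}" "t' \<in> {..<g}" "t \<noteq> t'"
        and "layer (j + int t) \<inter> layer (j + int t') \<noteq> {}"
      then obtain v where "v \<in> layer (j + int t)" "v \<in> layer (j + int t')" by blast
      then have "int q dvd int t - int t'" using in_layer_unique by fastforce
      moreover have "\<bar>int t - int t'\<bar> < int q" using t(1,2) g_eq \<epsilon>_le q_gt by simp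
      ultimately have "int t - int t' = 0" by (rule small_dvd_eq_0)
      then show False using t(3) by simp
    qed
  qed simp
  ultimately show ?thesis using double_count(1)[OF c] by simp
qed

text \<open>The sums of \<open>g\<close> consecutive layers starting at \<open>j\<close> and at
  \<open>j + 1\<close> are equal and differ only in their end terms.\<close>

lemma card_layer_periodic: "card (layer j) = card (layer (j + int g))"
proof -
  have "(\<Sum>t<Suc g. card (layer (j + int t))) = card (layer j) + (\<Sum>t<g. card (layer (j + 1 + int t)))"
    unfolding sum.lessThan_Suc_shift by (simp add: add.assoc)
  moreover have "(\<Sum>t<Suc g. card (layer (j + int t))) = (\<Sum>t<g. card (layer (j + int t))) + card (layer (j + int g))"
    by simp
  ultimately show ?thesis unfolding sum_layers by simp
qed

lemma layer_gball:
  assumes "u \<in> layer i"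
  shows "gball V E 1 u \<subseteq> layer (i - 1) \<union> layer i \<union> layer (i + 1)"
proof
  fix v assume v: "v \<in> gball V E 1 u"
  then have vV: "v \<in> V" by (simp add: gball_def)
  then have "near q 1 i (f v)" using v layer_near[OF assms, of v "f v" 1]
    by (auto simp: gball_def layer_def)
  then obtain x where x: "\<bar>x\<bar> \<le> int 1" "int q dvd f v - i - x" by (rule nearE)
  then consider "x = -1" | "x = 0" | "x = 1" by fastforce
  then show "v \<in> layer (i - 1) \<union> layer i \<union> layer (i + 1)"
    by cases (use vV x(2) in \<open>auto simp: layer_def algebra_simps\<close>)
qed

lemma layer_equatorial_partition: "equatorial_partition V E \<delta> g q layer"
proof -
  have nb: "(\<exists>v\<in>layer (i - 1). {u, v} \<in> E) \<and> (\<exists>v\<in>layer (i + 1). {u, v} \<in> E)" if u: "u \<in> layer i" for i u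
  proof -
    obtain c' where c': "isoseq V E q c'" "c' i = u" "\<And>j. c' j \<in> layer j"
      using layer_reroute[OF u] by blast
    have "{u, c' (i - 1)} \<in> E" "{u, c' (i + 1)} \<in> E"
      using isoseqD(2)[OF c'(1), of "i - 1"] isoseqD(2)[OF c'(1), of i] c'(2)
      by (auto simp: insert_commute)
    then show ?thesis using c'(3) by blast
  qed
  have cyc: "\<exists>!v. v \<in> set cs \<and> v \<in> layer j" if "isometric_cycle V E cs" "length cs = q" for cs j
    using layer_meets_cycle[of "\<lambda>i. cs ! nat (i mod int (length cs))"] isoseq_of_isometric_cycle[OF that(1)] that(2)
    by simp
  show ?thesis
    unfolding equatorial_partition_def Let_def k_def[symmetric]
    using layer_partition nb layer_gball cyc layer_eq_Int card_layer_periodic sum_layers by blast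
qed

text \<open>Along the cycle the indices in a second equatorial partition are \<open>r \<plusminus> j\<close>, and any other vertex is
  squeezed between two cycle vertices whose indices differ by \<open>2k\<close>.\<close>

lemma layer_unique:
  assumes L: "equatorial_partition V E \<delta> g q L"
  shows "cyclic_relabelling layer L"
proof -
  have per: "\<And>j. L (j + int q) = L j" and inj: "inj_on L {0..<int q}"
    and part: "partition_on V (L ` {0..<int q})"
    using L by (auto simp: equatorial_partition_def Let_def cyclic_partition_def)
  have ball: "\<And>i u. u \<in> L i \<Longrightarrow> gball V E 1 u \<subseteq> L (i - 1) \<union> L i \<union> L (i + 1)"
    and cyc: "\<And>cs j. isometric_cycle V E cs \<Longrightarrow> length cs = q \<Longrightarrow> \<exists>v. v \<in> set cs \<and> v \<in> L j"
    using L unfolding equatorial_partition_def Let_def by blast+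
  have perm: "L (j + int q * m) = L j" for j m
  proof (induction m rule: int_induct[where k = 0])
    case (step1 m)
    then show ?case using per[of "j + int q * m"] by (simp add: algebra_simps)
  next
    case (step2 m)
    then show ?case using per[of "j + int q * (m - 1)"] by (simp add: algebra_simps)
  qed simp
  have Lcong: "L i = L j" if "int q dvd i - j" for i j
  proof -
    from that obtain m where "i - j = int q * m" by (rule dvdE)
    then have "i = j + int q * m" by simp
    then show ?thesis using perm by simp
  qed
  have Lmod: "L j = L (j mod int q)" "j mod int q \<in> {0..<int q}" for j
    using Lcong[of j "j mod int q"] q_gt by (auto simp: dvd_minus_mod)
  have LV: "L j \<subseteq> V" for j
    using Lmod[of j] partition_onD1[OF part] by blast
  have uniq: "int q dvd i - j" if "v \<in> L i" "v \<in> L j" for v i j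
  proof -
    have "L (i mod int q) = L (j mod int q)"
      using disjointD[OF partition_onD2[OF part], of "L (i mod int q)" "L (j mod int q)"]
        Lmod[of i] Lmod[of j] that by blast
    then have "i mod int q = j mod int q" using inj Lmod(2) by (meson inj_onD)
    then show ?thesis by (simp add: mod_eq_dvd_iff)
  qed
  have "\<exists>i. v \<in> L i" if "v \<in> V" for v using that partition_onD1[OF part] by blast
  then obtain f' where f': "\<And>v. v \<in> V \<Longrightarrow> v \<in> L (f' v)" by metis
  have mem: "v \<in> L j \<longleftrightarrow> v \<in> V \<and> int q dvd f' v - j" for v j
    using f' uniq LV Lcong by blast
  have lip: "near q 1 (f' u) (f' v)" if "u \<in> V" "v \<in> V" "{u, v} \<in> E" for u v
  proof -
    have "v \<in> gball V E 1 u" using gdist_edge_le[OF that] that(2) by (simp add: gball_def)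
    then have "v \<in> L (f' u - 1) \<union> L (f' u) \<union> L (f' u + 1)" using ball[OF f'[OF that(1)]] by blast
    then show ?thesis
      using nearI[of "-1" 1 q "f' v" "f' u"] nearI[of 0 1 q "f' v" "f' u"] nearI[of 1 1 q "f' v" "f' u"]
      by (auto simp: mem algebra_simps)
  qed
  note cV = isoseqD(1)[OF c]
  have "\<exists>\<sigma> r. (\<sigma> = 1 \<or> \<sigma> = -1) \<and> (\<forall>j. int q dvd f' (c j) - (r + \<sigma> * j))"
  proof (rule winding[of q "\<lambda>j. f' (c j)" k])
    show "f' (c i) = f' (c j)" if "int q dvd i - j" for i j using isoseqD(3)[OF c that] by simp
    show "near q 1 (f' (c i)) (f' (c (i + 1)))" for i by (rule lip[OF cV cV isoseqD(2)[OF c]])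
    \<comment> \<open>By property (c) of \<open>L\<close> the cycle meets every part, so every
      residue is attained exactly.\<close>
    show "\<exists>j. near q k i (f' (c j))" for i
    proof -
      have "3 \<le> q" using q_gt by simp
      note ic = isometric_cycle_of_isoseq[OF c this]
      obtain v where "v \<in> range c" "v \<in> L i" using cyc[OF ic(1,2)] ic(3) by metis
      then obtain j where "int q dvd f' (c j) - i" by (auto simp: mem)
      then show ?thesis by (intro exI[of _ j] nearI[of 0]) auto
    qed
  qed (use q_gt in auto)
  then obtain \<sigma> r where \<sigma>: "\<sigma> = 1 \<or> \<sigma> = -1" and fr: "\<And>j. int q dvd f' (c j) - (r + \<sigma> * j)"
    by blast
  have f'f: "int q dvd r + \<sigma> * f u - f' u" if u: "u \<in> V" for u
  proof -
    have near: "near q k (f' u) (r + \<sigma> * j)" if "gdist V E u (c j) \<le> enat k" for j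
    proof -
      have "near q k (f' u) (f' (c j))" using lip that by (rule near_of_gdist_le)
      then show ?thesis by (rule near_cong) (use fr[of j] in \<open>simp_all add: dvd_diff_commute\<close>)
    qed
    note d = near[OF centreD(1)[OF f u]] near[OF centreD(2)[OF f u]]
    show ?thesis
      by (rule near_squeeze[of q k]) (use \<sigma> d q_gt in \<open>auto simp: algebra_simps\<close>)
  qed
  have "L j = layer (\<sigma> * (j - r))" for j
  proof -
    have "int q dvd f' u - j \<longleftrightarrow> int q dvd f u - \<sigma> * (j - r)" if u: "u \<in> V" for u
    proof -
      have "int q dvd f' u - j \<longleftrightarrow> int q dvd (f' u - j) + (r + \<sigma> * f u - f' u)"
        by (rule dvd_add_left_iff[OF f'f[OF u], symmetric])
      also have "(f' u - j) + (r + \<sigma> * f u - f' u) = \<sigma> * (f u - \<sigma> * (j - r))"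
        using \<sigma> by auto
      also have "int q dvd \<dots> \<longleftrightarrow> int q dvd f u - \<sigma> * (j - r)"
        using \<sigma> by (elim disjE) (simp_all only: mult_1 mult_minus1 dvd_minus_iff)
      finally show ?thesis .
    qed
    then show ?thesis by (auto simp: mem layer_def)
  qed
  then have "(\<forall>j. L j = layer (- r + j)) \<or> (\<forall>j. L j = layer (r - j))" using \<sigma> by auto
  then show ?thesis unfolding cyclic_relabelling_def by blast
qed

end

lemma on_isometric_cycle:
  assumes "v \<in> V"
  obtains c i where "isoseq V E q c" "c i = v"
  using isoseq_exists centre_exists reroute assms by metis

end

theorem theorem25:
  fixes V :: "'a set" and E :: "'a set set" and \<delta> g q :: nat
  assumes "equatorial_graph V E \<delta> g q"
  shows "(\<forall>v\<in>V. degree V E v = \<delta>) \<and>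
    (\<forall>v\<in>V. \<exists>cs. isometric_cycle V E cs \<and> length cs = q \<and> v \<in> set cs) \<and>
    (\<exists>L. equatorial_partition V E \<delta> g q L \<and>
      (\<forall>L'. equatorial_partition V E \<delta> g q L' \<longrightarrow> cyclic_relabelling L L'))"
proof -
  interpret equatorial V E \<delta> g q by unfold_locales (rule assms)
  have "degree V E v = \<delta>" if "v \<in> V" for v
    using on_isometric_cycle[OF that] degree_isoseq by metis
  moreover have "\<exists>cs. isometric_cycle V E cs \<and> length cs = q \<and> v \<in> set cs" if v: "v \<in> V" for v
  proof -
    obtain c i where c: "isoseq V E q c" "c i = v" using on_isometric_cycle[OF v] by blast
    have "3 \<le> q" using q_gt by simp
    from isometric_cycle_of_isoseq[OF c(1) this] c(2) show ?thesis by blast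
  qed
  moreover obtain c f where "isoseq V E q c" "centre c f"
    using isoseq_exists centre_exists by blast
  then have "\<exists>L. equatorial_partition V E \<delta> g q L \<and>
      (\<forall>L'. equatorial_partition V E \<delta> g q L' \<longrightarrow> cyclic_relabelling L L')"
    using layer_equatorial_partition layer_unique by blast
  ultimately show ?thesis by blast
qed

end
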